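(* Let $\kappa$ be an infinite cardinal less than the continuum, and assume $BP(\kappa)$. Let $X$ be a connected, locally path connected $\kappa$-Polish space. Then the fundamental group $\pi_1(X)$ has cardinality at most $\kappa$ or cardinality equal to the continuum.
   Context: A topological space is $\kappa$-separable if it has a dense subset of cardinality at most $\kappa$, and $\kappa$-Polish if it is completely metrizable and $\kappa$-separable. If $Y$ is a Polish space (separable, completely metrizable), a set $A\subseteq Y$ is $\kappa$-Suslin if there is a closed set $D\subseteq Y\times\kappa^{\mathbb{N}}$ (with $\kappa$ discrete and $\kappa^{\mathbb{N}}$ the product topology) whose projection to $Y$ is $A$. A set $A\subseteq Y$ has the property of Baire if there is an open $O\subseteq Y$ with $(A\cup O)\setminus(A\cap O)$ meager. $BP(\kappa)$ is the statement that every $\kappa$-Suslin subset of every Polish space has the property of Baire. *)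

theory Defs
  imports "HOL-Analysis.Analysis" "HOL-Library.Equipollence"
begin

definition kappa_separable :: "'k set \<Rightarrow> 'a topology \<Rightarrow> bool" where
  "kappa_separable K X \<longleftrightarrow>
     (\<exists>D. D \<subseteq> topspace X \<and> X closure_of D = topspace X \<and> D \<lesssim> K)"

definition kappa_Polish :: "'k set \<Rightarrow> 'a topology \<Rightarrow> bool" where
  "kappa_Polish K X \<longleftrightarrow> completely_metrizable_space X \<and> kappa_separable K X"

definition Polish_space :: "'a topology \<Rightarrow> bool" where
  "Polish_space X \<longleftrightarrow> completely_metrizable_space X \<and> separable_space X"

definition nowhere_dense_in :: "'a topology \<Rightarrow> 'a set \<Rightarrow> bool" where
  "nowhere_dense_in X S \<longleftrightarrow> S \<subseteq> topspace X \<and> X interior_of (X closure_of S) = {}"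

definition meager_in :: "'a topology \<Rightarrow> 'a set \<Rightarrow> bool" where
  "meager_in X S \<longleftrightarrow>
     (\<exists>F. countable F \<and> (\<forall>N\<in>F. nowhere_dense_in X N) \<and> S \<subseteq> \<Union>F)"

definition has_Baire_property :: "'a topology \<Rightarrow> 'a set \<Rightarrow> bool" where
  "has_Baire_property X A \<longleftrightarrow>
     (\<exists>U. openin X U \<and> meager_in X ((A \<union> U) - (A \<inter> U)))"

definition Baire_kappa :: "'k set \<Rightarrow> (nat \<Rightarrow> 'k) topology" where
  "Baire_kappa K = product_topology (\<lambda>_. discrete_topology K) UNIV"

definition kappa_Suslin :: "'k set \<Rightarrow> 'a topology \<Rightarrow> 'a set \<Rightarrow> bool" where
  "kappa_Suslin K Y A \<longleftrightarrow>
     (\<exists>D. closedin (prod_topology Y (Baire_kappa K)) D \<and> fst ` D = A)"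

text \<open>BP(kappa): every kappa-Suslin subset of every Polish space has the property of Baire.
  Every Polish space has cardinality at most the continuum, hence is homeomorphic to a
  topological space whose carrier is a subset of the reals; so quantifying over topologies
  on the type real covers all Polish spaces up to homeomorphism.\<close>
definition BP :: "'k set \<Rightarrow> bool" where
  "BP K \<longleftrightarrow> (\<forall>Y :: real topology. \<forall>A. Polish_space Y \<and> kappa_Suslin K Y A \<longrightarrow>
                  has_Baire_property Y A)"

definition loops_at :: "'a topology \<Rightarrow> 'a \<Rightarrow> (real \<Rightarrow> 'a) set" where
  "loops_at X x0 = {g. pathin X g \<and> g 0 = x0 \<and> g 1 = x0}"

definition loop_homotopic :: "'a topology \<Rightarrow> 'a \<Rightarrow> ((real \<Rightarrow> 'a) \<times> (real \<Rightarrow> 'a)) set" where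
  "loop_homotopic X x0 = {(g, h). g \<in> loops_at X x0 \<and> h \<in> loops_at X x0 \<and>
      homotopic_with (\<lambda>r. r 0 = x0 \<and> r 1 = x0) (top_of_set {0..1}) X g h}"

definition fundamental_group :: "'a topology \<Rightarrow> 'a \<Rightarrow> (real \<Rightarrow> 'a) set set" where
  "fundamental_group X x0 = loops_at X x0 // loop_homotopic X x0"

end

theory Submission
  imports Defs "HOL-Probability.Discrete_Topology"
begin

text \<open>
  The Kuratowski embedding turns \<open>X\<close> into a closed subset \<open>S\<close> of a Banach space, which makes the
  calculus of \<open>homotopic_paths\<close> available.

  If every point of \<open>S\<close> has a neighbourhood in which paths with common ends are homotopic in \<open>S\<close>,
  then uniformly close loops are homotopic, so a homotopy class is determined by finitely many points
  of a dense set of size \<open>\<kappa>\<close> and there are at most \<open>\<kappa>\<close> classes.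

  Otherwise some point \<open>x\<close> carries essential loops \<open>g\<^sub>n\<close> shrinking to \<open>x\<close>.  A bit sequence \<open>\<alpha>\<close>
  selects the infinite concatenation \<open>f\<^sub>\<alpha>\<close> of the \<open>g\<^sub>n\<close> with \<open>\<alpha> n\<close>.  The relation
  \<open>f\<^sub>\<alpha> \<simeq> f\<^sub>\<beta>\<close> is \<open>\<kappa>\<close>-Suslin, since a homotopy is coded by approximations of its values at rational
  points and a modulus of continuity; so it has the property of Baire.  Flipping one bit of \<open>\<alpha>\<close>
  changes the class of \<open>f\<^sub>\<alpha>\<close>, so the relation cannot be comeager in a cylinder and is therefore meager,
  and a meager relation has continuum many pairwise unrelated points.
\<close>

section \<open>Embedding into a Banach space\<close>

text \<open>Distinct bit sequences may well give homotopic concatenations, and nothing describes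
  directly when they do. What can be computed is the effect of a single change: common leading loops
  and a common tail cancel in the fundamental groupoid, so flipping bit n multiplies the class by a
  conjugate of an essential loop or of its inverse. Everything else about the relation is drawn from
  category.

  A pair of bit sequences is treated as one sequence over the finite alphabet of pairs of bits. A
  flip in the first component is then a change of one letter, and finiteness of the alphabet makes
  meager sets accessible through patterns on blocks.

  When \<kappa> is uncountable, \<open>S\<close> need not be separable, so homotopies are coded by
  sequences in \<kappa> rather than by points of a Polish space; this is where \<kappa>-Suslin sets
  and \<open>BP\<close> come in.

  In the second alternative the upper bound by the continuum comes from coding a path by its values
  at rationals, and each value by a sequence in a dense set with at most continuum many
  points.\<close>

lemma Metric_space_embeds_in_Banach:
  fixes M :: "'a set"
  assumes "Metric_space M d"
  obtains j :: "'a \<Rightarrow> 'a discrete \<Rightarrow>\<^sub>C real"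
  where "\<And>x y. \<lbrakk>x \<in> M; y \<in> M\<rbrakk> \<Longrightarrow> dist (j x) (j y) = d x y"
proof -
  interpret Metric_space M d by fact
  have tri: "\<bar>d x z - d y z\<bar> \<le> d x y" if "x \<in> M" "y \<in> M" "z \<in> M" for x y z
    using triangle[of x y z] triangle[of y x z] commute[of x y] that by auto
  define a where "a = (SOME a. a \<in> M)"
  \<comment> \<open>Kuratowski's functions: subtracting the distance to the base point
    \<open>a\<close> keeps them bounded, by \<open>d x a\<close>. Off \<open>M\<close> the value 0
    is a filler, and on the discrete type continuity is automatic.\<close>
  define e where "e x = (\<lambda>u. if of_discrete u \<in> M then d x (of_discrete u) - d a (of_discrete u) else 0)" for x
  have a: "a \<in> M" if "x \<in> M" for x
    using that unfolding a_def by (metis someI)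
  have e: "e x \<in> bcontfun" if "x \<in> M" for x
  proof (rule bcontfun_normI)
    show "continuous_on UNIV (e x)"
      by (simp add: continuous_on_open_vimage open_discrete)
    show "norm (e x u) \<le> d x a" for u
      using tri[of x a] that a[OF that] by (auto simp: e_def)
  qed
  define j where "j x = Bcontfun (e x)" for x
  have je: "apply_bcontfun (j x) = e x" if "x \<in> M" for x
    using e[OF that] by (simp add: j_def Bcontfun_inverse)
  have "dist (j x) (j y) = d x y" if xy: "x \<in> M" "y \<in> M" for x y
  proof (rule antisym)
    show "dist (j x) (j y) \<le> d x y"
      using xy tri by (intro dist_bound) (auto simp: je e_def dist_real_def)
    \<comment> \<open>The supremum distance is attained at the coordinate y, where the two functions
      differ by \<open>d x y - d y y\<close>.\<close>
    have "d x y = dist (apply_bcontfun (j x) (discrete y)) (apply_bcontfun (j y) (discrete y))"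
      using xy by (simp add: je e_def discrete_inverse dist_real_def)
    also have "\<dots> \<le> dist (j x) (j y)"
      by (rule dist_bounded)
    finally show "d x y \<le> dist (j x) (j y)" .
  qed
  then show thesis
    using that by blast
qed

lemma completely_metrizable_homeomorphic_closed_in_Banach:
  fixes X :: "'a topology"
  assumes "completely_metrizable_space X"
  obtains S :: "('a discrete \<Rightarrow>\<^sub>C real) set"
  where "closed S" "X homeomorphic_space top_of_set S"
proof -
  obtain M d where "Metric_space M d" and mc: "Metric_space.mcomplete M d"
    and X: "X = Metric_space.mtopology M d"
    using assms unfolding completely_metrizable_space_def by auto
  interpret Metric_space M d by fact
  obtain j :: "'a \<Rightarrow> 'a discrete \<Rightarrow>\<^sub>C real" where j: "\<And>x y. \<lbrakk>x \<in> M; y \<in> M\<rbrakk> \<Longrightarrow> dist (j x) (j y) = d x y"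
    using Metric_space_embeds_in_Banach[OF \<open>Metric_space M d\<close>] by blast
  have inj: "inj_on j M"
    using j by (metis dist_self inj_onI zero)
  define k where "k = inv_into M j"
  have kj: "k (j x) = x" if "x \<in> M" for x
    using inj that by (simp add: k_def)
  have "continuous_map mtopology euclidean j"
    unfolding continuous_map_def
  proof (intro conjI allI impI)
    fix U :: "('a discrete \<Rightarrow>\<^sub>C real) set" assume "openin euclidean U"
    then have U: "open U" by simp
    show "openin mtopology {x \<in> topspace mtopology. j x \<in> U}"
      unfolding openin_mtopology
    proof (intro conjI allI impI)
      fix x assume "x \<in> {x \<in> topspace mtopology. j x \<in> U}"
      then have x: "x \<in> M" "j x \<in> U" by auto
      then obtain r where "r > 0" "ball (j x) r \<subseteq> U"
        using U open_contains_ball by blast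
      then show "\<exists>r>0. mball x r \<subseteq> {x \<in> topspace mtopology. j x \<in> U}"
        using x j by (intro exI[of _ r]) (auto simp: subset_iff)
    qed auto
  qed auto
  then have cj: "continuous_map mtopology (top_of_set (j ` M)) j"
    by (simp add: continuous_map_in_subtopology)
  have ck: "continuous_map (top_of_set (j ` M)) mtopology k"
    unfolding continuous_map_def
  proof (intro conjI allI impI)
    show "k \<in> topspace (top_of_set (j ` M)) \<rightarrow> topspace mtopology"
      using kj by auto
    fix U assume "openin mtopology U"
    then have U: "U \<subseteq> M" "\<And>x. x \<in> U \<Longrightarrow> \<exists>r>0. mball x r \<subseteq> U"
      by (auto simp: openin_mtopology)
    have "\<exists>e>0. ball y e \<inter> j ` M \<subseteq> {x \<in> j ` M. k x \<in> U}" if y: "y \<in> {x \<in> j ` M. k x \<in> U}" for y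
    proof -
      obtain x where x: "x \<in> M" "y = j x" using y by auto
      with y have "x \<in> U" using kj by auto
      then obtain r where "r > 0" "mball x r \<subseteq> U" using U by blast
      then show ?thesis
        using x j kj by (intro exI[of _ r]) (auto simp: subset_iff)
    qed
    then show "openin (top_of_set (j ` M)) {x \<in> topspace (top_of_set (j ` M)). k x \<in> U}"
      by (auto simp: openin_contains_ball)
  qed
  have "homeomorphic_maps mtopology (top_of_set (j ` M)) j k"
    using cj ck kj by (auto simp: homeomorphic_maps_def)
  then have hom: "X homeomorphic_space top_of_set (j ` M)"
    using X homeomorphic_space_def by blast
  have "complete (j ` M)"
    unfolding complete_def
  proof (intro allI impI)
    fix f assume f: "(\<forall>n. f n \<in> j ` M) \<and> Cauchy f"
    then have "\<forall>n. \<exists>x. x \<in> M \<and> f n = j x"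
      by auto
    then obtain g where g: "\<And>n. g n \<in> M" "\<And>n. f n = j (g n)"
      by metis
    have "MCauchy g"
      unfolding MCauchy_def
    proof (intro conjI allI impI)
      fix e :: real assume "e > 0"
      then obtain N where "\<forall>m\<ge>N. \<forall>n\<ge>N. dist (f m) (f n) < e"
        using f unfolding Cauchy_def by blast
      then show "\<exists>N. \<forall>n n'. N \<le> n \<longrightarrow> N \<le> n' \<longrightarrow> d (g n) (g n') < e"
        using g j by (intro exI[of _ N]) auto
    qed (use g in auto)
    then obtain l where l: "limitin mtopology g l sequentially"
      using mc mcomplete_def by blast
    then have "l \<in> M" 
      by (simp add: limitin_mspace)
    have "f \<longlonglongrightarrow> j l"
    proof (rule tendstoI)
      fix e :: real assume "e > 0"
      then have "\<forall>\<^sub>F n in sequentially. g n \<in> M \<and> d (g n) l < e"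
        using l by (simp add: limitin_metric)
      then show "\<forall>\<^sub>F n in sequentially. dist (f n) (j l) < e"
        using j g \<open>l \<in> M\<close> by (auto elim!: eventually_mono)
    qed
    then show "\<exists>l\<in>j ` M. f \<longlonglongrightarrow> l"
      using \<open>l \<in> M\<close> by blast
  qed
  then have "closed (j ` M)"
    by (rule complete_imp_closed)
  with hom show thesis
    using that by blast
qed

section \<open>Homotopic nearby paths\<close>

lemma homotopic_paths_reversepath_cancel:
  fixes S :: "'a::real_normed_vector set"
  assumes "path p" "path_image p \<subseteq> S" "path q" "path_image q \<subseteq> S" "pathfinish p = pathstart q"
  shows "homotopic_paths S (reversepath p +++ (p +++ q)) q"
proof -
  have "homotopic_paths S (reversepath p +++ (p +++ q)) ((reversepath p +++ p) +++ q)"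
    using assms by (intro homotopic_paths_assoc) auto
  also have "homotopic_paths S ((reversepath p +++ p) +++ q) (linepath (pathfinish p) (pathfinish p) +++ q)"
    using assms by (intro homotopic_paths_join homotopic_paths_linv) auto
  also have "homotopic_paths S (linepath (pathfinish p) (pathfinish p) +++ q) q"
    using assms by (intro homotopic_paths_lid') auto
  finally show ?thesis .
qed

lemma homotopic_paths_cancel_left:
  fixes S :: "'a::real_normed_vector set"
  assumes hom: "homotopic_paths S (p +++ q) (p +++ r)"
    and p: "path p" "path_image p \<subseteq> S"
    and q: "path q" "path_image q \<subseteq> S" "pathfinish p = pathstart q"
    and r: "path r" "path_image r \<subseteq> S" "pathfinish p = pathstart r"
  shows "homotopic_paths S q r"
proof -
  have "homotopic_paths S q (reversepath p +++ (p +++ q))"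
    using p q by (intro homotopic_paths_sym[OF homotopic_paths_reversepath_cancel])
  also have "homotopic_paths S (reversepath p +++ (p +++ q)) (reversepath p +++ (p +++ r))"
    by (rule homotopic_paths_join) (use hom p q in auto)
  also have "homotopic_paths S (reversepath p +++ (p +++ r)) r"
    using p r by (intro homotopic_paths_reversepath_cancel)
  finally show ?thesis .
qed

lemma homotopic_paths_cancel_right:
  fixes S :: "'a::real_normed_vector set"
  assumes hom: "homotopic_paths S (q +++ p) (r +++ p)"
    and p: "path p" "path_image p \<subseteq> S"
    and q: "path q" "path_image q \<subseteq> S" "pathfinish q = pathstart p"
    and r: "path r" "path_image r \<subseteq> S" "pathfinish r = pathstart p"
  shows "homotopic_paths S q r"
proof -
  have "homotopic_paths S (reversepath p +++ reversepath q) (reversepath p +++ reversepath r)"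
    using hom q r by (metis homotopic_paths_reversepath reversepath_joinpaths)
  then have "homotopic_paths S (reversepath q) (reversepath r)"
    by (rule homotopic_paths_cancel_left) (use p q r in auto)
  then show ?thesis
    by (simp only: homotopic_paths_reversepath)
qed

text \<open>The local condition behind semilocal simple connectedness: the paths stay in
  \<open>V\<close>, but the homotopy may wander through \<open>S\<close>. It is equivalent to
  null-homotopy in \<open>S\<close> of all loops in \<open>V\<close>; the form with two paths is the
  one that small quadrilaterals produce.\<close>

definition trivial_in :: "'a::topological_space set \<Rightarrow> 'a set \<Rightarrow> bool" where
  "trivial_in S V \<longleftrightarrow> (\<forall>p q. path p \<and> path q \<and> path_image p \<subseteq> V \<and> path_image q \<subseteq> V \<and>
     pathstart p = pathstart q \<and> pathfinish p = pathfinish q \<longrightarrow> homotopic_paths S p q)"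

lemma trivial_inD:
  assumes "trivial_in S V" "path p" "path q" "path_image p \<subseteq> V" "path_image q \<subseteq> V"
    "pathstart p = pathstart q" "pathfinish p = pathfinish q"
  shows "homotopic_paths S p q"
  using assms unfolding trivial_in_def by blast

lemma trivial_in_mono: "trivial_in S V \<Longrightarrow> W \<subseteq> V \<Longrightarrow> trivial_in S W"
  unfolding trivial_in_def by (meson subset_trans)

text \<open>The radius is a Lebesgue number of the cover of \<open>C\<close> by open sets whose
  trace on \<open>S\<close> is trivial in \<open>S\<close>.\<close>

lemma trivial_in_uniform:
  fixes S :: "'a::metric_space set"
  assumes "\<And>x. x \<in> S \<Longrightarrow> \<exists>r>0. trivial_in S (S \<inter> ball x r)" and "compact C" "C \<subseteq> S"
  obtains \<rho> where "\<rho> > 0" "\<And>x. x \<in> C \<Longrightarrow> trivial_in S (S \<inter> ball x \<rho>)"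
proof -
  define \<G> where "\<G> = {U. open U \<and> trivial_in S (S \<inter> U)}"
  have "C \<subseteq> \<Union>\<G>"
  proof
    fix x assume "x \<in> C"
    then obtain r where "r > 0" "trivial_in S (S \<inter> ball x r)"
      using assms by blast
    then show "x \<in> \<Union>\<G>"
      unfolding \<G>_def by (intro UnionI[of "ball x r"]) auto
  qed
  moreover have "open G" if "G \<in> \<G>" for G
    using that by (simp add: \<G>_def)
  ultimately obtain \<rho> where "\<rho> > 0" "\<And>x. x \<in> C \<Longrightarrow> \<exists>G\<in>\<G>. ball x \<rho> \<subseteq> G"
    using Heine_Borel_lemma[OF \<open>compact C\<close>] by metis
  moreover have "trivial_in S (S \<inter> ball x \<rho>)" if "ball x \<rho> \<subseteq> G" "G \<in> \<G>" for x G
    using that by (auto simp: \<G>_def intro: trivial_in_mono)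
  ultimately show thesis
    using that by metis
qed

text \<open>Again a Lebesgue number, now for open sets whose trace on \<open>S\<close> is small and
  path connected.\<close>

lemma locally_path_connected_uniform:
  fixes S :: "'a::metric_space set"
  assumes "locally path_connected S" and "compact C" "C \<subseteq> S" and "\<rho> > 0"
  obtains \<eta> where "\<eta> > 0"
    "\<And>x y. \<lbrakk>x \<in> C; y \<in> S; dist x y < \<eta>\<rbrakk> \<Longrightarrow>
       \<exists>p. path p \<and> path_image p \<subseteq> S \<inter> ball x \<rho> \<and> pathstart p = x \<and> pathfinish p = y"
proof -
  \<comment> \<open>The centre z is left free: all points of \<open>S \<inter> U\<close> are within
    \<rho>/2 of z, so the ball of radius \<rho> about any one of them contains
    \<open>S \<inter> U\<close>.\<close>
  define \<G> where "\<G> = {U. open U \<and> path_connected (S \<inter> U) \<and> (\<exists>z. S \<inter> U \<subseteq> ball z (\<rho>/2))}"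
  have "C \<subseteq> \<Union>\<G>"
  proof
    fix x assume "x \<in> C"
    then have "openin (top_of_set S) (S \<inter> ball x (\<rho>/2))" "x \<in> S \<inter> ball x (\<rho>/2)"
      using assms by auto
    then obtain V where "openin (top_of_set S) V" "path_connected V" "x \<in> V" "V \<subseteq> S \<inter> ball x (\<rho>/2)"
      using assms(1) unfolding locally_path_connected by metis
    moreover from this obtain U where "open U" "V = S \<inter> U"
      by (auto simp: openin_open)
    ultimately show "x \<in> \<Union>\<G>"
      unfolding \<G>_def by (intro UnionI[of U]) auto
  qed
  moreover have "open G" if "G \<in> \<G>" for G
    using that by (simp add: \<G>_def)
  ultimately obtain \<eta> where \<eta>: "\<eta> > 0" "\<And>x. x \<in> C \<Longrightarrow> \<exists>G\<in>\<G>. ball x \<eta> \<subseteq> G"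
    using Heine_Borel_lemma[OF \<open>compact C\<close>] by metis
  show thesis
  proof (rule that[of \<eta>])
    fix x y assume xy: "x \<in> C" "y \<in> S" "dist x y < \<eta>"
    obtain U z where U: "ball x \<eta> \<subseteq> U" "path_connected (S \<inter> U)" "S \<inter> U \<subseteq> ball z (\<rho>/2)"
      using \<eta>(2)[OF xy(1)] unfolding \<G>_def by blast
    then have "x \<in> S \<inter> U" "y \<in> S \<inter> U"
      using xy \<eta>(1) assms(3) by auto
    then obtain p where p: "path p" "path_image p \<subseteq> S \<inter> U" "pathstart p = x" "pathfinish p = y"
      using U(2) unfolding path_connected_def by blast
    have "S \<inter> U \<subseteq> ball x \<rho>"
    proof
      fix w assume "w \<in> S \<inter> U"
      then have "dist z w < \<rho>/2" "dist z x < \<rho>/2"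
        using U(3) \<open>x \<in> S \<inter> U\<close> by auto
      then show "w \<in> ball x \<rho>"
        using dist_triangle3[of x w z] by simp
    qed
    then show "\<exists>p. path p \<and> path_image p \<subseteq> S \<inter> ball x \<rho> \<and> pathstart p = x \<and> pathfinish p = y"
      using p by blast
  qed (fact \<eta>)
qed

text \<open>Subdivide \<open>[0, 1]\<close> finely and join \<open>g\<close> to \<open>h\<close> at the subdivision points by short paths: the resulting
  small quadrilaterals lie in balls where paths with common ends are homotopic.\<close>

lemma close_paths_homotopic:
  fixes S :: "'a::real_normed_vector set"
  assumes lpc: "locally path_connected S"
    and triv: "\<And>x. x \<in> S \<Longrightarrow> \<exists>r>0. trivial_in S (S \<inter> ball x r)"
    and g: "path g" "path_image g \<subseteq> S"
  obtains \<epsilon> where "\<epsilon> > 0"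
    "\<And>h. \<lbrakk>path h; path_image h \<subseteq> S; pathstart h = pathstart g; pathfinish h = pathfinish g;
          \<And>t. t \<in> {0..1} \<Longrightarrow> dist (g t) (h t) < \<epsilon>\<rbrakk> \<Longrightarrow> homotopic_paths S g h"
proof -
  have C: "compact (path_image g)"
    using g by blast
  obtain \<rho> where \<rho>: "\<rho> > 0" "\<And>x. x \<in> path_image g \<Longrightarrow> trivial_in S (S \<inter> ball x \<rho>)"
    using trivial_in_uniform[OF triv C g(2)] by blast
  \<comment> \<open>The budget for one quadrilateral based at \<open>g (t i)\<close> is \<rho>. A
    connecting path has extent \<rho>/2, the next one starts less than \<rho>/4 away, and
    \<open>h\<close> stays within \<rho>/4 of \<open>g\<close>, hence within \<rho>/2 of the base
    point.\<close>
  obtain \<eta> where \<eta>: "\<eta> > 0"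
    "\<And>x y. \<lbrakk>x \<in> path_image g; y \<in> S; dist x y < \<eta>\<rbrakk> \<Longrightarrow>
       \<exists>p. path p \<and> path_image p \<subseteq> S \<inter> ball x (\<rho>/2) \<and> pathstart p = x \<and> pathfinish p = y"
    using locally_path_connected_uniform[OF lpc C g(2), of "\<rho>/2"] \<rho>(1) by (metis half_gt_zero)
  have "uniformly_continuous_on {0..1} g"
    using g(1) by (simp add: path_def compact_uniformly_continuous)
  then obtain \<delta> where \<delta>: "\<delta> > 0"
    "\<And>s t. \<lbrakk>s \<in> {0..1}; t \<in> {0..1}; dist t s < \<delta>\<rbrakk> \<Longrightarrow> dist (g t) (g s) < \<rho>/4"
    unfolding uniformly_continuous_on_def using \<rho>(1)
    by (metis zero_less_divide_iff zero_less_numeral)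
  obtain n :: nat where n: "n > 0" "1/n < \<delta>"
    using \<delta>(1) real_arch_inverse[of \<delta>] by (auto simp: field_simps)
  define t where "t i = real i / n" for i
  have t: "t i \<in> {0..1}" if "i \<le> n" for i
    using that n by (auto simp: t_def)
  have t0: "t 0 = 0" "t n = 1"
    using n by (auto simp: t_def)
  have tS: "t i \<le> t (Suc i)" "t (Suc i) - t i < \<delta>" for i
    using n by (auto simp: t_def field_simps)
  show thesis
  proof (rule that[of "min \<eta> (\<rho>/4)"])
    fix h
    assume h: "path h" "path_image h \<subseteq> S" and ends: "pathstart h = pathstart g" "pathfinish h = pathfinish g"
      and close: "\<And>t. t \<in> {0..1} \<Longrightarrow> dist (g t) (h t) < min \<eta> (\<rho>/4)"
    have gS: "g s \<in> path_image g" "h s \<in> S" "g s \<in> S" if "s \<in> {0..1}" for s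
      using that g(2) h(2) by (auto simp: path_image_def)
    have "\<forall>i\<in>{..n}. \<exists>p. path p \<and> path_image p \<subseteq> S \<inter> ball (g (t i)) (\<rho>/2) \<and>
             pathstart p = g (t i) \<and> pathfinish p = h (t i)"
      using \<eta>(2) gS close t by simp
    then obtain p where p: "\<And>i. i \<le> n \<Longrightarrow> path (p i)"
      "\<And>i. i \<le> n \<Longrightarrow> path_image (p i) \<subseteq> S \<inter> ball (g (t i)) (\<rho>/2)"
      "\<And>i. i \<le> n \<Longrightarrow> pathstart (p i) = g (t i)" "\<And>i. i \<le> n \<Longrightarrow> pathfinish (p i) = h (t i)"
      unfolding bchoice_iff atMost_iff by blast
    have pS: "path_image (p i) \<subseteq> S" if "i \<le> n" for i
      using p(2)[OF that] by blast
    have sub: "path (subpath u v g)" "path (subpath u v h)"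
        "path_image (subpath u v g) \<subseteq> S" "path_image (subpath u v h) \<subseteq> S"
      if "u \<in> {0..1}" "v \<in> {0..1}" for u v
      using g h path_image_subpath_subset[OF that, of g] path_image_subpath_subset[OF that, of h]
      by (auto simp only: path_subpath[OF _ that])
    \<comment> \<open>At the two ends \<open>g\<close> and \<open>h\<close> agree, yet the chosen
      connecting path need not be constant; it is a small loop and therefore null-homotopic.\<close>
    have nullp: "homotopic_paths S (p i) (linepath (g (t i)) (g (t i)))"
      if "i \<le> n" "g (t i) = h (t i)" for i
    proof (rule trivial_inD[OF \<rho>(2)])
      show "g (t i) \<in> path_image g" using t that gS by blast
      show "path_image (p i) \<subseteq> S \<inter> ball (g (t i)) \<rho>"
        using p(2)[OF that(1)] \<rho>(1) by (auto simp: subset_iff)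
      show "path_image (linepath (g (t i)) (g (t i))) \<subseteq> S \<inter> ball (g (t i)) \<rho>"
        using gS(3)[OF t[OF that(1)]] that \<rho>(1) by auto
    qed (use p that in auto)
    \<comment> \<open>Each induction step glues one more quadrilateral to the strip between
      \<open>g\<close> and \<open>h\<close>. For \<open>i = n\<close> the strip is complete, and the
      two outer connecting paths contract by \<open>nullp\<close>.\<close>
    have claim: "homotopic_paths S (subpath 0 (t i) g +++ p i) (p 0 +++ subpath 0 (t i) h)" if "i \<le> n" for i
      using that
    proof (induction i)
      case 0
      have "homotopic_paths S (linepath (g 0) (g 0) +++ p 0) (p 0)"
        using p[of 0] pS[of 0] t0 by (intro homotopic_paths_lid') auto
      moreover have "homotopic_paths S (p 0 +++ linepath (h 0) (h 0)) (p 0)"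
        using p[of 0] pS[of 0] t0 by (intro homotopic_paths_rid') auto
      ultimately show ?case
        unfolding t0 subpath_refl by (metis homotopic_paths_sym homotopic_paths_trans)
    next
      case (Suc i)
      let ?i = "t i" and ?j = "t (Suc i)"
      have ij: "?i \<in> {0..1}" "?j \<in> {0..1}" "?i \<le> ?j"
        using t tS Suc.prems by (auto simp del: atLeastAtMost_iff)
      have i: "i \<le> n" "Suc i \<le> n" using Suc.prems by auto
      note P = p(1)[OF i(1)] p(3,4)[OF i(1)] pS[OF i(1)]
      note P' = p(1)[OF i(2)] p(3,4)[OF i(2)] pS[OF i(2)]
      have p0: "path (p 0)" "pathfinish (p 0) = h 0" "path_image (p 0) \<subseteq> S"
        using p[of 0] pS[of 0] t0 by auto
      have z: "0 \<in> {0..1::real}" by simp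
      note subs = sub[OF z ij(1)] sub[OF z ij(2)] sub[OF ij(1,2)]
      have gi: "dist (g ?i) (g s) < \<rho>/4" if "s \<in> {?i..?j}" for s
        using \<delta>(2)[of s ?i] that ij tS(2)[of i] by (auto simp: dist_real_def)
      have hi: "dist (g ?i) (h s) < \<rho>/2" if "s \<in> {?i..?j}" for s
        using gi[OF that] close[of s] that ij dist_triangle[of "g ?i" "h s" "g s"] by auto
      have mid: "homotopic_paths S (subpath ?i ?j g +++ p (Suc i)) (p i +++ subpath ?i ?j h)"
      proof (rule trivial_inD[OF \<rho>(2)])
        show "g ?i \<in> path_image g" using gS ij by blast
        have "path_image (subpath ?i ?j g) \<subseteq> S \<inter> ball (g ?i) \<rho>"
          using gi subs(11) \<rho>(1) ij by (force simp: path_image_subpath)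
        moreover have "path_image (p (Suc i)) \<subseteq> S \<inter> ball (g ?i) \<rho>"
        proof
          fix x assume "x \<in> path_image (p (Suc i))"
          then have "x \<in> S" "dist (g ?j) x < \<rho>/2"
            using p(2)[OF i(2)] by auto
          then show "x \<in> S \<inter> ball (g ?i) \<rho>"
            using gi[of ?j] ij dist_triangle[of "g ?i" x "g ?j"] \<rho>(1) by auto
        qed
        ultimately show "path_image (subpath ?i ?j g +++ p (Suc i)) \<subseteq> S \<inter> ball (g ?i) \<rho>"
          using subset_path_image_join by blast
        have "path_image (subpath ?i ?j h) \<subseteq> S \<inter> ball (g ?i) \<rho>"
          using hi subs(12) \<rho>(1) ij by (force simp: path_image_subpath)
        moreover have "path_image (p i) \<subseteq> S \<inter> ball (g ?i) \<rho>"
          using p(2)[OF i(1)] \<rho>(1) by (auto simp: subset_iff)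
        ultimately show "path_image (p i +++ subpath ?i ?j h) \<subseteq> S \<inter> ball (g ?i) \<rho>"
          using subset_path_image_join by blast
      qed (use P P' subs in auto)
      have "homotopic_paths S (subpath 0 ?j g +++ p (Suc i)) ((subpath 0 ?i g +++ subpath ?i ?j g) +++ p (Suc i))"
        by (rule homotopic_paths_join[OF homotopic_paths_sym[OF homotopic_join_subpaths]])
          (use g P' ij in auto)
      also have "homotopic_paths S ((subpath 0 ?i g +++ subpath ?i ?j g) +++ p (Suc i))
                  (subpath 0 ?i g +++ (subpath ?i ?j g +++ p (Suc i)))"
        by (rule homotopic_paths_sym[OF homotopic_paths_assoc]) (use subs P' in auto)
      also have "homotopic_paths S (subpath 0 ?i g +++ (subpath ?i ?j g +++ p (Suc i)))
                  (subpath 0 ?i g +++ (p i +++ subpath ?i ?j h))"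
        by (rule homotopic_paths_join[OF _ mid]) (use subs in auto)
      also have "homotopic_paths S (subpath 0 ?i g +++ (p i +++ subpath ?i ?j h))
                   ((subpath 0 ?i g +++ p i) +++ subpath ?i ?j h)"
        by (rule homotopic_paths_assoc) (use subs P in auto)
      also have "homotopic_paths S ((subpath 0 ?i g +++ p i) +++ subpath ?i ?j h) ((p 0 +++ subpath 0 ?i h) +++ subpath ?i ?j h)"
        by (rule homotopic_paths_join[OF Suc.IH]) (use i subs P in auto)
      also have "homotopic_paths S ((p 0 +++ subpath 0 ?i h) +++ subpath ?i ?j h) (p 0 +++ (subpath 0 ?i h +++ subpath ?i ?j h))"
        by (rule homotopic_paths_sym[OF homotopic_paths_assoc]) (use subs p0 in auto)
      also have "homotopic_paths S (p 0 +++ (subpath 0 ?i h +++ subpath ?i ?j h)) (p 0 +++ subpath 0 ?j h)"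
        by (rule homotopic_paths_join[OF _ homotopic_join_subpaths]) (use h p0 ij in auto)
      finally show ?case .
    qed
    have e: "g 0 = h 0" "g 1 = h 1"
      using ends by (auto simp: pathstart_def pathfinish_def)
    have "homotopic_paths S g (g +++ linepath (g 1) (g 1))"
      using g by (intro homotopic_paths_sym[OF homotopic_paths_rid']) (auto simp: pathfinish_def)
    also have "homotopic_paths S (g +++ linepath (g 1) (g 1)) (g +++ p n)"
      using g nullp[of n] e t0 by (intro homotopic_paths_join) (auto simp: pathfinish_def homotopic_paths_sym)
    also have "homotopic_paths S (g +++ p n) (p 0 +++ h)"
      using claim[of n] t0 by simp
    also have "homotopic_paths S (p 0 +++ h) (linepath (h 0) (h 0) +++ h)"
      using h nullp[of 0] p[of 0] e t0 by (intro homotopic_paths_join) (auto simp: pathstart_def pathfinish_def)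
    also have "homotopic_paths S (linepath (h 0) (h 0) +++ h) h"
      using h by (intro homotopic_paths_lid') (auto simp: pathstart_def)
    finally show "homotopic_paths S g h" .
  qed (use \<eta> \<rho> in auto)
qed

section \<open>Counting homotopy classes\<close>

lemma infinite_pairing:
  assumes "infinite K"
  obtains e where "inj_on e (K \<times> K)" "e ` (K \<times> K) \<subseteq> K"
proof -
  have "\<exists>e. inj_on e (K \<times> K) \<and> e ` (K \<times> K) \<subseteq> K"
    unfolding card_of_ordLeq
    by (rule ordIso_imp_ordLeq[OF card_of_Times_same_infinite[OF assms]])
  then show thesis
    using that by blast
qed

lemma dense_subset_approx:
  fixes D :: "'a::metric_space set"
  assumes "S \<subseteq> closure D" "x \<in> S" "e > 0"
  shows "\<exists>y\<in>D. dist y x < e"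
  using assms closure_approachable by blast

lemma closure_Rats_unit_interval: "closure (\<rat> \<inter> {0..1}) = {0..1::real}"
proof
  show "closure (\<rat> \<inter> {0..1}) \<subseteq> {0..1::real}"
    by (rule closure_minimal) auto
  have "{0..1} = closure {0<..<1::real}"
    by simp
  also have "\<dots> = closure ({0<..<1} \<inter> \<rat>)"
    by (rule closure_open_Int_superset[symmetric]) (auto simp: Rats_closure_real)
  also have "\<dots> \<subseteq> closure (\<rat> \<inter> {0..1})"
    by (rule closure_mono) auto
  finally show "{0..1::real} \<subseteq> closure (\<rat> \<inter> {0..1})" .
qed

lemma continuous_on_eq_if_eq_Rats:
  fixes f g :: "real \<Rightarrow> 'a::t2_space"
  assumes "continuous_on {0..1} f" "continuous_on {0..1} g"
    and "\<And>t. t \<in> \<rat> \<inter> {0..1} \<Longrightarrow> f t = g t" and t: "t \<in> {0..1}"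
  shows "f t = g t"
proof -
  let ?F = "at t within (\<rat> \<inter> {0..1})"
  show ?thesis
  proof (cases "t \<in> \<rat>")
    case False
    have "t \<in> closure (\<rat> \<inter> {0..1})"
      using t by (simp only: closure_Rats_unit_interval)
    then have "t islimpt (\<rat> \<inter> {0..1})"
      using False by (simp add: closure_def)
    then have nb: "?F \<noteq> bot"
      by (simp add: trivial_limit_within)
    have lim: "(f \<longlongrightarrow> f t) (at t within {0..1})" "(g \<longlongrightarrow> g t) (at t within {0..1})"
      using assms(1,2) t by (simp_all add: continuous_on_def)
    have "(f \<longlongrightarrow> f t) ?F" "(g \<longlongrightarrow> g t) ?F"
      using lim[THEN tendsto_within_subset] by auto
    moreover have "eventually (\<lambda>s. f s = g s) ?F"
      using assms(3) by (auto simp: eventually_at_filter)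
    ultimately show ?thesis
      using nb tendsto_cong[of f g ?F] tendsto_unique[of ?F g] by metis
  qed (use assms in auto)
qed

text \<open>With reals replaced by sets of naturals, a sequence of reals is a subset of the plane of
  pairs of naturals, which \<open>prod_encode\<close> turns into one set of naturals.\<close>

lemma sequences_of_reals_lepoll: "(UNIV :: (nat \<Rightarrow> real) set) \<lesssim> (UNIV :: real set)"
proof -
  obtain b :: "nat set \<Rightarrow> real" where b: "bij b"
    using nat_sets_eqpoll_reals eqpoll_def by blast
  define f where "f s = b {prod_encode (i, j) | i j. j \<in> inv b (s i)}" for s :: "nat \<Rightarrow> real"
  have "inj f"
  proof (rule injI)
    fix s s' assume "f s = f s'"
    then have eq: "{prod_encode (i, j) | i j. j \<in> inv b (s i)} = {prod_encode (i, j) | i j. j \<in> inv b (s' i)}"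
      unfolding f_def using b by (meson bij_is_inj injD)
    have "j \<in> inv b (s i) \<longleftrightarrow> j \<in> inv b (s' i)" for i j
    proof -
      have "prod_encode (i, j) \<in> {prod_encode (i, j) | i j. j \<in> inv b (s i)} \<longleftrightarrow>
            prod_encode (i, j) \<in> {prod_encode (i, j) | i j. j \<in> inv b (s' i)}"
        using eq by simp
      then show ?thesis by auto
    qed
    then have "inv b (s i) = inv b (s' i)" for i by blast
    then show "s = s'"
      by (intro ext) (metis b bij_inv_eq_iff)
  qed
  then show ?thesis
    by (auto simp: lepoll_def)
qed

text \<open>The code lists, for every rational point and every accuracy, a point of \<open>D\<close>
  near the value of the path. The approximation \<open>a x l\<close> is chosen from the point
  \<open>x\<close> alone, so equal codes mean equal approximating sequences and hence equal
  limits.\<close>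

lemma paths_determined_by_real:
  fixes S D :: "'a::metric_space set"
  assumes D: "S \<subseteq> closure D" "D \<lesssim> (UNIV :: real set)"
  obtains \<xi> :: "(real \<Rightarrow> 'a) \<Rightarrow> real" where
    "\<And>g h t. \<lbrakk>path g; path_image g \<subseteq> S; path h; path_image h \<subseteq> S; \<xi> g = \<xi> h; t \<in> {0..1}\<rbrakk> \<Longrightarrow> g t = h t"
proof -
  obtain \<iota> :: "'a \<Rightarrow> real" where \<iota>: "inj_on \<iota> D"
    using D(2) unfolding lepoll_def by blast
  obtain \<sigma> :: "(nat \<Rightarrow> real) \<Rightarrow> real" where \<sigma>: "inj \<sigma>"
    using sequences_of_reals_lepoll unfolding lepoll_def by blast
  define r where "r = from_nat_into (\<rat> \<inter> {0..1::real})"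
  have "countable (\<rat> \<inter> {0..1::real})" "\<rat> \<inter> {0..1::real} \<noteq> {}"
    using countable_rat by auto
  then have r: "range r = \<rat> \<inter> {0..1}"
    unfolding r_def by (rule range_from_nat_into[rotated])
  define a where "a x l = (SOME y. y \<in> D \<and> dist y x < inverse (Suc l))" for x and l :: nat
  have a: "a x l \<in> D" "dist (a x l) x < inverse (Suc l)" if "x \<in> S" for x l
    using someI_ex[of "\<lambda>y. y \<in> D \<and> dist y x < inverse (Suc l)"]
      dense_subset_approx[OF D(1) that, of "inverse (Suc l)"]
    unfolding a_def by auto
  define \<xi> where "\<xi> g = \<sigma> (\<lambda>i. case prod_decode i of (j, l) \<Rightarrow> \<iota> (a (g (r j)) l))" for g
  show thesis
  proof (rule that[of \<xi>])
    fix g h t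
    assume g: "path g" "path_image g \<subseteq> S" and h: "path h" "path_image h \<subseteq> S"
      and eq: "\<xi> g = \<xi> h" and t: "t \<in> {0..1::real}"
    have S: "g s \<in> S" "h s \<in> S" if "s \<in> {0..1}" for s
      using g h that by (auto simp: path_image_def)
    show "g t = h t"
    proof (rule continuous_on_eq_if_eq_Rats[OF _ _ _ t])
      fix s :: real assume "s \<in> \<rat> \<inter> {0..1}"
      then obtain j where j: "s = r j" "s \<in> {0..1}"
        using r by (metis IntD2 imageE)
      have e: "a (g s) l = a (h s) l" for l
      proof -
        have "(\<lambda>i. case prod_decode i of (j, l) \<Rightarrow> \<iota> (a (g (r j)) l)) (prod_encode (j, l)) =
              (\<lambda>i. case prod_decode i of (j, l) \<Rightarrow> \<iota> (a (h (r j)) l)) (prod_encode (j, l))"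
          using eq \<sigma> unfolding \<xi>_def by (metis injD)
        then have "\<iota> (a (g s) l) = \<iota> (a (h s) l)"
          using j by simp
        then show ?thesis
          using \<iota> a(1) S j(2) by (meson inj_onD)
      qed
      have lim: "(\<lambda>l. a x l) \<longlonglongrightarrow> x" if "x \<in> S" for x
        by (rule tendsto_dist_iff[THEN iffD2], rule tendsto_sandwich[OF always_eventually always_eventually tendsto_const LIMSEQ_inverse_real_of_nat])
          (simp_all add: less_imp_le[OF a(2)[OF that]] del: of_nat_Suc)
      show "g s = h s"
        using lim[OF S(1)[OF j(2)]] lim[OF S(2)[OF j(2)]] LIMSEQ_unique unfolding e by metis
    qed (use g h in \<open>auto simp: path_def\<close>)
  qed
qed

text \<open>Each path gets a finite code: an accuracy \<open>m\<close>, a mesh \<open>n\<close>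
  adapted to its modulus of continuity, and points of \<open>D\<close> near its values at the n + 1
  grid points. Paths with the same code are uniformly close at a scale where closeness already
  implies \<open>R\<close>. Finite codes over an infinite \<open>K\<close> fit into
  \<open>K\<close>.\<close>

lemma open_classes_of_paths_lepoll:
  fixes S D :: "'a::metric_space set" and K :: "'k set"
  assumes K: "infinite K" and D: "S \<subseteq> closure D" "D \<lesssim> K"
    and L: "\<And>g. g \<in> L \<Longrightarrow> path g" "\<And>g. g \<in> L \<Longrightarrow> path_image g \<subseteq> S"
    and R: "\<And>g. g \<in> L \<Longrightarrow> \<exists>\<epsilon>>0. \<forall>h\<in>L. (\<forall>t\<in>{0..1}. dist (g t) (h t) < \<epsilon>) \<longrightarrow> R g h"
  obtains \<phi> where "\<phi> \<in> L \<rightarrow> K" "\<And>g h. \<lbrakk>g \<in> L; h \<in> L; \<phi> g = \<phi> h\<rbrakk> \<Longrightarrow> R g h"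
proof -
  obtain \<iota> where \<iota>: "inj_on \<iota> D" "\<iota> ` D \<subseteq> K"
    using D(2) unfolding lepoll_def by blast
  obtain \<nu> :: "nat \<Rightarrow> 'k" where \<nu>: "inj \<nu>" "range \<nu> \<subseteq> K"
    using K infinite_countable_subset by blast
  obtain e where e: "inj_on e (K \<times> K)" "e ` (K \<times> K) \<subseteq> K"
    using infinite_pairing[OF K] by blast
  have eK: "e (x, y) \<in> K" if "x \<in> K" "y \<in> K" for x y
    using e(2) that by blast
  have einj: "x = x' \<and> y = y'" if "e (x, y) = e (x', y')" "x \<in> K" "y \<in> K" "x' \<in> K" "y' \<in> K" for x y x' y'
    using inj_onD[OF e(1) that(1)] that by auto
  \<comment> \<open>Folds the first \<open>n\<close> entries of \<open>a\<close> into one element of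
    \<open>K\<close>. The length cannot be read off the result, since \<open>\<nu> 0\<close> may
    also be a value of \<open>e\<close>; this is why \<phi> records the length separately.\<close>
  define c where "c = (\<lambda>n a. rec_nat (\<nu> 0) (\<lambda>i z. e (\<iota> (a i), z)) n)"
  have c_simps: "c 0 a = \<nu> 0" "c (Suc n) a = e (\<iota> (a n), c n a)" for n a
    by (simp_all add: c_def)
  have cK: "c n a \<in> K" if "\<And>i. i < n \<Longrightarrow> a i \<in> D" for n a
    using that
  proof (induction n)
    case (Suc n)
    then have "\<iota> (a n) \<in> K"
      using \<iota>(2) by blast
    then show ?case
      unfolding c_simps using Suc by (intro eK) auto
  qed (use \<nu>(2) in \<open>auto simp: c_simps\<close>)
  have cinj: "a i = b i" if "c n a = c n b" "i < n" "\<And>i. i < n \<Longrightarrow> a i \<in> D" "\<And>i. i < n \<Longrightarrow> b i \<in> D" for n a b i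
    using that
  proof (induction n)
    case (Suc n)
    have "\<iota> (a n) = \<iota> (b n) \<and> c n a = c n b"
      using Suc.prems(1) unfolding c_simps
      by (rule einj) (use Suc.prems \<iota>(2) cK in auto)
    then have "a n = b n" "i < n \<Longrightarrow> a i = b i"
      using Suc \<iota>(1) by (auto dest: inj_onD)
    then show ?case
      using Suc.prems(2) less_Suc_eq by blast
  qed simp
  \<comment> \<open>The factor 4 counts the distances on the way from \<open>g t\<close> to
    \<open>h t\<close>: to \<open>g s\<close> at a grid point \<open>s\<close>, to the common point
    \<open>a i\<close>, to \<open>h s\<close>, and to \<open>h t\<close>.\<close>
  define P where "P g m n a \<longleftrightarrow> n > 0 \<and>
      (\<forall>h\<in>L. (\<forall>t\<in>{0..1}. dist (g t) (h t) < 4 / real (Suc m)) \<longrightarrow> R g h) \<and>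
      (\<forall>i<Suc n. a i \<in> D \<and> dist (a i) (g (real i / real n)) < 1 / real (Suc m)) \<and>
      (\<forall>s\<in>{0..1}. \<forall>t\<in>{0..1}. \<bar>s - t\<bar> \<le> 1 / real n \<longrightarrow> dist (g s) (g t) < 1 / real (Suc m))"
    for g m n a
  have "\<exists>m n a. P g m n a" if g: "g \<in> L" for g
  proof -
    obtain \<epsilon> where \<epsilon>: "\<epsilon> > 0" "\<And>h. \<lbrakk>h \<in> L; \<forall>t\<in>{0..1}. dist (g t) (h t) < \<epsilon>\<rbrakk> \<Longrightarrow> R g h"
      using R[OF g] by blast
    obtain m where m: "4 / real (Suc m) < \<epsilon>"
      using reals_Archimedean[of "\<epsilon>/4"] \<epsilon>(1) by (auto simp: field_simps)
    have "uniformly_continuous_on {0..1} g"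
      using L(1)[OF g] by (simp add: path_def compact_uniformly_continuous)
    then obtain \<delta> where \<delta>: "\<delta> > 0"
      "\<And>s t. \<lbrakk>s \<in> {0..1}; t \<in> {0..1}; dist t s < \<delta>\<rbrakk> \<Longrightarrow> dist (g t) (g s) < 1 / real (Suc m)"
      by (rule uniformly_continuous_onE[of _ _ "1 / real (Suc m)"]) auto
    obtain n :: nat where n: "n > 0" "1/n < \<delta>"
      using \<delta>(1) real_arch_inverse[of \<delta>] by (auto simp: field_simps)
    have "\<forall>i. \<exists>y. i \<le> n \<longrightarrow> y \<in> D \<and> dist y (g (real i / real n)) < 1 / real (Suc m)"
    proof (intro allI)
      fix i show "\<exists>y. i \<le> n \<longrightarrow> y \<in> D \<and> dist y (g (real i / real n)) < 1 / real (Suc m)"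
      proof (cases "i \<le> n")
        case True
        then have "g (real i / real n) \<in> S"
          using L(2)[OF g] n by (auto simp: path_image_def)
        then show ?thesis
          using dense_subset_approx[OF D(1), of _ "1 / real (Suc m)"] by fastforce
      qed auto
    qed
    then obtain a where "\<And>i. i \<le> n \<Longrightarrow> a i \<in> D \<and> dist (a i) (g (real i / real n)) < 1 / real (Suc m)"
      by metis
    moreover have "R g h" if "h \<in> L" "\<forall>t\<in>{0..1}. dist (g t) (h t) < 4 / real (Suc m)" for h
      using \<epsilon>(2) that m by (meson less_trans)
    moreover have "dist (g s) (g t) < 1 / real (Suc m)"
      if "s \<in> {0..1}" "t \<in> {0..1}" "\<bar>s - t\<bar> \<le> 1 / real n" for s t
      using \<delta>(2)[of t s] that n by (simp add: dist_real_def)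
    ultimately have "P g m n a"
      unfolding P_def using n(1) by (auto simp: less_Suc_eq_le simp del: of_nat_Suc)
    then show ?thesis by blast
  qed
  then obtain m n a where P: "\<And>g. g \<in> L \<Longrightarrow> P g (m g) (n g) (a g)"
    by metis
  have aD: "a g i \<in> D" if "g \<in> L" "i < Suc (n g)" for g i
    using P[OF that(1)] that(2) by (auto simp: P_def)
  define \<phi> where "\<phi> g = e (\<nu> (m g), e (\<nu> (n g), c (Suc (n g)) (a g)))" for g
  have \<nu>K: "\<nu> i \<in> K" for i
    using \<nu>(2) by blast
  show thesis
  proof (rule that[of \<phi>])
    show "\<phi> \<in> L \<rightarrow> K"
      unfolding \<phi>_def using aD by (auto intro!: eK cK \<nu>K simp del: c_simps)
    fix g h assume g: "g \<in> L" and h: "h \<in> L" and eq: "\<phi> g = \<phi> h"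
    have cg: "c (Suc (n g)) (a g) \<in> K" and ch: "c (Suc (n h)) (a h) \<in> K"
      using cK aD g h by blast+
    have "\<nu> (m g) = \<nu> (m h) \<and> e (\<nu> (n g), c (Suc (n g)) (a g)) = e (\<nu> (n h), c (Suc (n h)) (a h))"
      using eq unfolding \<phi>_def by (rule einj) (intro \<nu>K eK cg ch)+
    then have m: "m g = m h" and "e (\<nu> (n g), c (Suc (n g)) (a g)) = e (\<nu> (n h), c (Suc (n h)) (a h))"
      using \<nu>(1) by (auto dest: injD)
    from this(2) have "\<nu> (n g) = \<nu> (n h) \<and> c (Suc (n g)) (a g) = c (Suc (n h)) (a h)"
      by (rule einj) (intro \<nu>K cg ch)+
    then have n: "n g = n h" and "c (Suc (n g)) (a g) = c (Suc (n g)) (a h)"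
      using \<nu>(1) by (auto dest: injD)
    then have a: "a g i = a h i" if "i < Suc (n g)" for i
      using cinj[OF _ that] aD g h by metis
    let ?n = "n g" and ?\<epsilon> = "1 / real (Suc (m g))"
    have Pg: "P g (m g) ?n (a g)" and Ph: "P h (m g) ?n (a h)"
      using P[OF g] P[OF h] m n by auto
    have "dist (g t) (h t) < 4 / real (Suc (m g))" if t: "t \<in> {0..1}" for t
    proof -
      define i where "i = nat \<lfloor>t * real ?n\<rfloor>"
      have npos: "?n > 0" using Pg by (simp add: P_def)
      have i: "real i \<le> t * real ?n" "t * real ?n < real i + 1"
        using t by (auto simp: i_def)
      have "t * real ?n \<le> real ?n"
        using t by (simp add: mult_left_le_one_le)
      then have "i \<le> ?n" using i(1) by linarith
      define s where "s = real i / real ?n"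
      have s: "s \<in> {0..1}"
        using \<open>i \<le> ?n\<close> npos by (simp add: s_def)
      have ts: "\<bar>t - s\<bar> \<le> 1 / real ?n"
      proof -
        have "t - s = (t * real ?n - real i) / real ?n"
          using npos by (simp add: s_def field_simps)
        then show ?thesis
          using i npos by (simp add: divide_right_mono)
      qed
      have "dist (g t) (g s) < ?\<epsilon>" "dist (h t) (h s) < ?\<epsilon>"
        using Pg Ph s ts t unfolding P_def by blast+
      moreover have "dist (a g i) (g s) < ?\<epsilon>" "dist (a g i) (h s) < ?\<epsilon>"
        using Pg Ph a[of i] \<open>i \<le> ?n\<close> unfolding P_def s_def by (metis less_Suc_eq_le)+
      ultimately have "dist (g t) (h t) < 4 * ?\<epsilon>"
        using dist_triangle[of "g t" "h t" "g s"] dist_triangle[of "g s" "h t" "h s"]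
          dist_triangle3[of "g s" "h s" "a g i"] dist_commute[of "h s" "h t"] by linarith
      then show ?thesis by simp
    qed
    then show "R g h"
      using Pg h unfolding P_def by blast
  qed
qed

section \<open>Infinite concatenations of loops\<close>

text \<open>The loop \<open>h n\<close> is run through on the interval from \<open>1 - 2\<^sup>-\<^sup>n\<close> to \<open>1 - 2\<^sup>-\<^sup>n\<^sup>-\<^sup>1\<close>.\<close>

definition infinite_concat :: "(nat \<Rightarrow> real \<Rightarrow> 'a) \<Rightarrow> 'a \<Rightarrow> real \<Rightarrow> 'a" where
  "infinite_concat h x t =
     (if t < 1 then let n = (LEAST n. t < 1 - (1/2) ^ Suc n) in h n (2 ^ Suc n * (t - (1 - (1/2) ^ n)))
      else x)"

text \<open>The second clause is what makes the infinite concatenation continuous at 1.\<close>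

definition null_loops :: "'a::metric_space set \<Rightarrow> 'a \<Rightarrow> (nat \<Rightarrow> real \<Rightarrow> 'a) \<Rightarrow> bool" where
  "null_loops S x h \<longleftrightarrow>
     (\<forall>n. path (h n) \<and> path_image (h n) \<subseteq> S \<and> pathstart (h n) = x \<and> pathfinish (h n) = x) \<and>
     (\<forall>e>0. \<exists>N. \<forall>n\<ge>N. path_image (h n) \<subseteq> ball x e)"

lemma null_loopsD:
  assumes "null_loops S x h"
  shows "path (h n)" "path_image (h n) \<subseteq> S" "pathstart (h n) = x" "pathfinish (h n) = x"
    "h n 0 = x" "h n 1 = x"
  using assms by (auto simp: null_loops_def pathstart_def pathfinish_def)

lemma null_loops_Suc: "null_loops S x h \<Longrightarrow> null_loops S x (\<lambda>n. h (Suc n))"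
  unfolding null_loops_def by (meson le_SucI)

lemma infinite_concat_0: "infinite_concat h x 0 = h 0 0"
proof -
  have "(LEAST n. 0 < 1 - (1/2::real) ^ Suc n) = 0"
    by (rule Least_eq_0) simp
  then show ?thesis
    by (simp add: infinite_concat_def)
qed

lemma infinite_concat_1: "infinite_concat h x 1 = x"
  by (simp add: infinite_concat_def)

lemma ex_dyadic_greater: "t < (1::real) \<Longrightarrow> \<exists>n. t < 1 - (1/2) ^ Suc n"
proof -
  assume "t < 1"
  then obtain n where "(1/2::real) ^ n < 1 - t"
    using real_arch_pow_inv[of "1 - t" "1/2"] by auto
  moreover have "(1/2::real) ^ Suc n \<le> (1/2) ^ n"
    by (rule power_decreasing) auto
  ultimately have "t < 1 - (1/2) ^ Suc n"
    by linarith
  then show ?thesis ..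
qed

text \<open>The index and the inner parameter depend on \<open>t\<close> alone. Two concatenations
  can thus be compared at \<open>t\<close> loop by loop, and the value at \<open>t\<close> involves
  a single member of the sequence.\<close>

lemma infinite_concat_local:
  assumes "0 \<le> t" "t < 1"
  shows "\<exists>n s. s \<in> {0..1} \<and> (\<forall>h (x::'a). infinite_concat h x t = h n s)"
proof -
  define n where "n = (LEAST n. t < 1 - (1/2) ^ Suc n)"
  define s where "s = 2 ^ Suc n * (t - (1 - (1/2) ^ n))"
  have "t < 1 - (1/2) ^ Suc n"
    unfolding n_def by (rule LeastI_ex[OF ex_dyadic_greater[OF assms(2)]])
  then have "t - (1 - (1/2) ^ n) < (1/2) ^ Suc n"
    by simp
  then have "s < 2 ^ Suc n * (1/2) ^ Suc n"
    unfolding s_def by (rule mult_strict_left_mono) simp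
  also have "\<dots> = 1"
    by (simp flip: power_mult_distrib)
  finally have "s \<le> 1" by simp
  moreover have "1 - (1/2) ^ n \<le> t"
  proof (cases n)
    case (Suc m)
    then have "\<not> t < 1 - (1/2) ^ Suc m"
      unfolding n_def by (metis lessI not_less_Least)
    with Suc show ?thesis by simp
  qed (use assms in simp)
  then have "0 \<le> s"
    unfolding s_def by simp
  moreover have "infinite_concat h x t = h n s" for h and x :: 'a
    using assms(2) by (simp add: infinite_concat_def n_def s_def Let_def)
  ultimately show ?thesis
    by (intro exI[of _ n] exI[of _ s]) simp
qed

text \<open>Self-similarity of the dyadic schedule: the substitution 2t - 1 lowers the index by one.
  At t = 1/2 the left side reads the start of \<open>h 1\<close> and the right side the end of
  \<open>h 0\<close>, whence the two hypotheses on end points.\<close>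

lemma infinite_concat_rec:
  assumes "h 0 1 = x" "h 1 0 = x" "t \<le> 1"
  shows "infinite_concat h x t = (h 0 +++ infinite_concat (\<lambda>n. h (Suc n)) x) t"
proof -
  let ?L = "LEAST n. t < 1 - (1/2) ^ Suc n"
  let ?M = "LEAST n. 2 * t - 1 < 1 - (1/2) ^ Suc n"
  consider "t < 1/2" | "t = 1/2" | "1/2 < t" "t < 1" | "t = 1"
    using assms(3) by linarith
  then show ?thesis
  proof cases
    case 1
    then have "?L = 0"
      by (intro Least_eq_0) simp
    with 1 show ?thesis
      by (simp add: infinite_concat_def joinpaths_def)
  next
    case 4
    then show ?thesis
      by (simp add: infinite_concat_def joinpaths_def)
  next
    case 3
    have "t < 1 - (1/2) ^ Suc (Suc n) \<longleftrightarrow> 2 * t - 1 < 1 - (1/2) ^ Suc n" for n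
      by auto
    then have L: "?L = Suc ?M"
      using 3 ex_dyadic_greater[of t] Least_Suc[of "\<lambda>n. t < 1 - (1/2) ^ Suc n"] by fastforce
    have "2 ^ Suc (Suc m) * (t - (1 - (1/2) ^ Suc m)) = 2 ^ Suc m * (2 * t - 1 - (1 - (1/2) ^ m))" for m
      by (simp add: field_simps)
    then show ?thesis
      using 3 by (simp add: infinite_concat_def joinpaths_def L Let_def del: power_Suc)
  next
    case 2
    have L: "?L = Suc 0"
      by (rule Least_equality) (auto simp: 2 not_less_eq_eq[symmetric] intro!: Suc_leI Nat.gr0I)
    have "infinite_concat h x t = h 1 0"
      unfolding infinite_concat_def Let_def L by (simp add: 2)
    then show ?thesis
      unfolding 2 using assms by (simp add: joinpaths_def)
  qed
qed

lemma path_infinite_concat_eventually_const: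
  fixes h :: "nat \<Rightarrow> real \<Rightarrow> 'a::topological_space"
  assumes "\<And>n. path (h n)" "\<And>n. h n 0 = x" "\<And>n. h n 1 = x"
  shows "path (infinite_concat (\<lambda>n. if n < N then h n else (\<lambda>_. x)) x)"
  using assms
proof (induction N arbitrary: h)
  case 0
  have "infinite_concat (\<lambda>n _. x) x = (\<lambda>_. x)"
    by (rule ext) (simp add: infinite_concat_def Let_def)
  then show ?case
    by (simp add: path_def)
next
  case (Suc N)
  let ?k = "\<lambda>n. if n < Suc N then h n else (\<lambda>_. x)"
  let ?k' = "\<lambda>n. if n < N then h (Suc n) else (\<lambda>_. x)"
  have k': "?k' = (\<lambda>n. ?k (Suc n))"
    by auto
  have "path (h 0 +++ infinite_concat ?k' x)"
    using Suc.IH[of "\<lambda>n. h (Suc n)"] Suc.prems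
    by (intro path_join_imp) (auto simp: pathstart_def pathfinish_def infinite_concat_0)
  then show ?case
  proof (rule path_eq)
    fix t :: real assume "t \<in> {0..1}"
    then show "(h 0 +++ infinite_concat ?k' x) t = infinite_concat ?k x t"
      unfolding k' using infinite_concat_rec[of ?k x t] Suc.prems by simp
  qed
qed

text \<open>The concatenation is the uniform limit of its truncations, in which all loops from some
  index on are constant. At each \<open>t\<close> the two either agree or differ by a point of a
  late loop against \<open>x\<close>.\<close>

lemma path_infinite_concat:
  fixes x :: "'a::metric_space"
  assumes "null_loops S x h"
  shows "path (infinite_concat h x)"
proof -
  note h = null_loopsD[OF assms]
  let ?k = "\<lambda>N. infinite_concat (\<lambda>n. if n < N then h n else (\<lambda>_. x)) x"
  have "uniform_limit {0..1} ?k (infinite_concat h x) sequentially"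
    unfolding uniform_limit_iff
  proof (intro allI impI)
    fix e :: real assume "e > 0"
    then obtain N where N: "\<And>n. n \<ge> N \<Longrightarrow> path_image (h n) \<subseteq> ball x e"
      using assms unfolding null_loops_def by meson
    have "dist (?k M t) (infinite_concat h x t) < e" if "M \<ge> N" "t \<in> {0..1}" for M t
    proof (cases "t = 1")
      case False
      then have "0 \<le> t" "t < 1"
        using that by auto
      from infinite_concat_local[OF this]
      obtain n s where "s \<in> {0..1} \<and> (\<forall>h (x::'a). infinite_concat h x t = h n s)"
        by (elim exE) (rule that)
      then have s: "s \<in> {0..1}" "\<And>h (x::'a). infinite_concat h x t = h n s"
        by simp_all
      show ?thesis
      proof (cases "n < M")
        case False
        then have "h n s \<in> ball x e"
          using N[of n] that s(1) by (simp add: path_image_def image_subset_iff)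
        with False show ?thesis
          by (simp add: s(2))
      qed (simp add: s(2) \<open>e > 0\<close>)
    qed (simp add: infinite_concat_1 \<open>e > 0\<close>)
    then show "\<forall>\<^sub>F M in sequentially. \<forall>t\<in>{0..1}. dist (?k M t) (infinite_concat h x t) < e"
      unfolding eventually_sequentially by (intro exI[of _ N]) blast
  qed
  moreover have "continuous_on {0..1} (?k N)" for N
    using path_infinite_concat_eventually_const h unfolding path_def by blast
  ultimately show ?thesis
    unfolding path_def by (intro uniform_limit_theorem[OF always_eventually]) auto
qed

lemma infinite_concat_loop:
  fixes x :: "'a::metric_space"
  assumes "null_loops S x h"
  shows "path_image (infinite_concat h x) \<subseteq> S"
    "pathstart (infinite_concat h x) = x" "pathfinish (infinite_concat h x) = x"
proof -
  note h = null_loopsD[OF assms]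
  show st: "pathstart (infinite_concat h x) = x" "pathfinish (infinite_concat h x) = x"
    by (simp_all add: pathstart_def pathfinish_def infinite_concat_0 infinite_concat_1 h)
  have "infinite_concat h x t \<in> S" if "t \<in> {0..1}" for t
  proof (cases "t = 1")
    case True
    then show ?thesis
      using h(2)[of 0] h(5)[of 0] by (auto simp: infinite_concat_1 path_image_def)
  next
    case False
    then have "0 \<le> t" "t < 1"
      using that by auto
    from infinite_concat_local[OF this]
    obtain n s where "s \<in> {0..1} \<and> (\<forall>h (x::'a). infinite_concat h x t = h n s)"
      by (elim exE) (rule that)
    then have s: "s \<in> {0..1}" "\<And>h (x::'a). infinite_concat h x t = h n s"
      by simp_all
    then show ?thesis
      using h(2)[of n] by (auto simp: path_image_def)
  qed
  then show "path_image (infinite_concat h x) \<subseteq> S"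
    by (auto simp: path_image_def)
qed

lemma infinite_concat_homotopic_rec:
  assumes "null_loops S x h"
  shows "homotopic_paths S (infinite_concat h x) (h 0 +++ infinite_concat (\<lambda>n. h (Suc n)) x)"
  by (rule homotopic_paths_eq[OF path_infinite_concat[OF assms] infinite_concat_loop(1)[OF assms]])
    (simp add: infinite_concat_rec null_loopsD[OF assms])

text \<open>By \<open>infinite_concat_homotopic_rec\<close> the common loops before \<open>n\<close>
  are split off and cancelled on the left one at a time; then the common tail, taken as one path, is
  cancelled on the right.\<close>

lemma homotopic_factor_of_infinite_concat:
  fixes S :: "'a::real_normed_vector set"
  assumes "null_loops S x h" "null_loops S x h'" "\<And>i. i \<noteq> n \<Longrightarrow> h i = h' i"
    and "homotopic_paths S (infinite_concat h x) (infinite_concat h' x)"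
  shows "homotopic_paths S (h n) (h' n)"
  using assms
proof (induction n arbitrary: h h')
  case 0
  let ?T = "infinite_concat (\<lambda>n. h (Suc n)) x"
  have T: "(\<lambda>n. h' (Suc n)) = (\<lambda>n. h (Suc n))"
    using "0.prems"(3) by auto
  have "homotopic_paths S (h 0 +++ ?T) (h' 0 +++ ?T)"
    using infinite_concat_homotopic_rec[OF "0.prems"(1)] infinite_concat_homotopic_rec[OF "0.prems"(2)]
      "0.prems"(4) unfolding T by (meson homotopic_paths_sym homotopic_paths_trans)
  then show ?case
    by (rule homotopic_paths_cancel_right)
      (use null_loopsD[OF "0.prems"(1)] null_loopsD[OF "0.prems"(2)]
         path_infinite_concat[OF null_loops_Suc[OF "0.prems"(1)]]
         infinite_concat_loop[OF null_loops_Suc[OF "0.prems"(1)]] in auto)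
next
  case (Suc n)
  let ?T = "infinite_concat (\<lambda>n. h (Suc n)) x" and ?T' = "infinite_concat (\<lambda>n. h' (Suc n)) x"
  note N = null_loops_Suc[OF Suc.prems(1)] and N' = null_loops_Suc[OF Suc.prems(2)]
  have h0: "h' 0 = h 0"
    using Suc.prems(3)[of 0] by simp
  have "homotopic_paths S (h 0 +++ ?T) (h 0 +++ ?T')"
    using infinite_concat_homotopic_rec[OF Suc.prems(1)] infinite_concat_homotopic_rec[OF Suc.prems(2)]
      Suc.prems(4) unfolding h0 by (meson homotopic_paths_sym homotopic_paths_trans)
  then have "homotopic_paths S ?T ?T'"
    by (rule homotopic_paths_cancel_left)
      (use null_loopsD[OF Suc.prems(1)] path_infinite_concat[OF N] infinite_concat_loop[OF N]
         path_infinite_concat[OF N'] infinite_concat_loop[OF N'] in auto)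
  then show ?case
    using Suc.IH[OF N N'] Suc.prems(3) by simp
qed

section \<open>The property of Baire and meager relations\<close>

lemma homeomorphic_map_nowhere_dense_in:
  assumes f: "homeomorphic_map X Y f" and N: "nowhere_dense_in X N"
  shows "nowhere_dense_in Y (f ` N)"
proof -
  have "N \<subseteq> topspace X" "X closure_of N \<subseteq> topspace X"
    using N by (auto simp: nowhere_dense_in_def closure_of_subset_topspace)
  then have "Y interior_of (Y closure_of (f ` N)) = f ` (X interior_of (X closure_of N))"
    using f by (simp add: homeomorphic_map_closure_of homeomorphic_map_interior_of)
  moreover have "f ` N \<subseteq> topspace Y"
    using f \<open>N \<subseteq> topspace X\<close> homeomorphic_imp_surjective_map by blast
  ultimately show ?thesis
    using N by (simp add: nowhere_dense_in_def)
qed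

lemma homeomorphic_map_meager_in:
  assumes "homeomorphic_map X Y f" and "meager_in X S"
  shows "meager_in Y (f ` S)"
proof -
  obtain F where "countable F" "\<forall>N\<in>F. nowhere_dense_in X N" "S \<subseteq> \<Union>F"
    using assms(2) unfolding meager_in_def by blast
  moreover have "f ` S \<subseteq> \<Union>((`) f ` F)"
    using image_mono[OF \<open>S \<subseteq> \<Union>F\<close>, of f] by (simp add: image_Union)
  ultimately show ?thesis
    unfolding meager_in_def using homeomorphic_map_nowhere_dense_in[OF assms(1)]
    by (intro exI[of _ "(`) f ` F"]) simp
qed

lemma inj_on_homeomorphic_copy:
  fixes Z :: "'z topology" and f :: "'z \<Rightarrow> 'y"
  assumes f: "inj_on f (topspace Z)"
  obtains Y where "homeomorphic_maps Z Y f (inv_into (topspace Z) f)"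
proof -
  define g where "g = inv_into (topspace Z) f"
  define Y where "Y = pullback_topology (f ` topspace Z) g Z"
  have gf: "g (f x) = x" if "x \<in> topspace Z" for x
    using f that by (simp add: g_def)
  have top: "topspace Y = f ` topspace Z"
    unfolding Y_def topspace_pullback_topology using gf by auto
  have "continuous_map Y Z g"
    unfolding Y_def by (rule continuous_map_pullback[OF continuous_map_id, unfolded id_comp])
  moreover have "continuous_map Z Y f"
    unfolding Y_def
  proof (rule continuous_map_pullback')
    show "continuous_map Z Z (g \<circ> f)"
      by (rule continuous_map_eq[OF continuous_map_id]) (simp add: gf)
  qed auto
  ultimately have "homeomorphic_maps Z Y f g"
    using gf by (auto simp: homeomorphic_maps_def top)
  then show thesis
    using that g_def by blast
qed

text \<open>\<open>BP\<close> speaks of topologies on the reals. A space with at most continuum many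
  points has a homeomorphic copy there; the closed set witnessing the Suslin property is pulled back
  along the inverse, and the open set and meager difference are carried back.\<close>

lemma BP_has_Baire_property:
  fixes Z :: "'z topology" and K :: "'k set"
  assumes "BP K" and Z: "Polish_space Z" and card: "topspace Z \<lesssim> (UNIV :: real set)"
    and A: "kappa_Suslin K Z A"
  shows "has_Baire_property Z A"
proof -
  obtain f :: "'z \<Rightarrow> real" where f: "inj_on f (topspace Z)"
    using card unfolding lepoll_def by blast
  define g where "g = inv_into (topspace Z) f"
  obtain Y where fg: "homeomorphic_maps Z Y f g"
    using inj_on_homeomorphic_copy[OF f] unfolding g_def by blast
  then have hf: "homeomorphic_map Z Y f" and hg: "homeomorphic_map Y Z g"
    using homeomorphic_maps_map by blast+
  have cf: "continuous_map Z Y f" and cg: "continuous_map Y Z g"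
    and gf: "\<And>z. z \<in> topspace Z \<Longrightarrow> g (f z) = z" and fg': "\<And>y. y \<in> topspace Y \<Longrightarrow> f (g y) = y"
    using fg by (auto simp: homeomorphic_maps_def)
  have fY: "f z \<in> topspace Y" if "z \<in> topspace Z" for z
    using cf that by (auto simp: continuous_map_def)
  have gZ: "g y \<in> topspace Z" if "y \<in> topspace Y" for y
    using cg that by (auto simp: continuous_map_def)
  have "Z homeomorphic_space Y"
    using fg homeomorphic_space_def by blast
  then have Y: "Polish_space Y"
    using Z unfolding Polish_space_def
    by (metis homeomorphic_completely_metrizable_space homeomorphic_separable_space)
  obtain D where D: "closedin (prod_topology Z (Baire_kappa K)) D" "fst ` D = A"
    using A unfolding kappa_Suslin_def by blast
  have DZ: "fst p \<in> topspace Z" "snd p \<in> topspace (Baire_kappa K)" if "p \<in> D" for p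
    using closedin_subset[OF D(1)] that by auto
  then have AZ: "A \<subseteq> topspace Z"
    using D(2) by blast
  define D' where "D' = {p \<in> topspace (prod_topology Y (Baire_kappa K)). (\<lambda>p. (g (fst p), snd p)) p \<in> D}"
  have "continuous_map (prod_topology Y (Baire_kappa K)) (prod_topology Z (Baire_kappa K)) (\<lambda>p. (g (fst p), snd p))"
    by (intro continuous_map_pairedI continuous_map_snd continuous_map_compose[OF continuous_map_fst cg, unfolded comp_def])
  then have "closedin (prod_topology Y (Baire_kappa K)) D'"
    unfolding D'_def using D(1) closedin_continuous_map_preimage by blast
  moreover have "fst ` D' = f ` A"
  proof (intro equalityI subsetI)
    fix y assume "y \<in> fst ` D'"
    then obtain c where c: "y \<in> topspace Y" "(g y, c) \<in> D"
      by (auto simp: D'_def)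
    then have "g y \<in> A"
      using D(2) by force
    then show "y \<in> f ` A"
      using fg'[OF c(1)] by (metis imageI)
  next
    fix y assume "y \<in> f ` A"
    then obtain p where p: "p \<in> D" "y = f (fst p)"
      using D(2) by blast
    then have "(y, snd p) \<in> D'"
      using DZ[OF p(1)] by (simp add: D'_def fY gf)
    then show "y \<in> fst ` D'"
      by force
  qed
  ultimately have "kappa_Suslin K Y (f ` A)"
    unfolding kappa_Suslin_def by blast
  then obtain U where U: "openin Y U" "meager_in Y (f ` A \<union> U - f ` A \<inter> U)"
    using \<open>BP K\<close> Y unfolding BP_def has_Baire_property_def by blast
  have gfA: "g ` f ` A = A"
    using AZ gf by (force simp: image_iff)
  have "g ` (f ` A \<union> U - f ` A \<inter> U) = A \<union> g ` U - A \<inter> g ` U"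
  proof -
    have "inj_on g (topspace Y)"
      using fg' by (metis inj_onI)
    moreover have "f ` A \<subseteq> topspace Y" "U \<subseteq> topspace Y"
      using AZ fY openin_subset[OF U(1)] by auto
    ultimately show ?thesis
      by (subst inj_on_image_set_diff[of g "topspace Y"])
        (auto simp: image_Un inj_on_image_Int[of g "topspace Y"] gfA)
  qed
  moreover have "meager_in Z (g ` (f ` A \<union> U - f ` A \<inter> U))"
    by (rule homeomorphic_map_meager_in[OF hg U(2)])
  moreover have "openin Z (g ` U)"
    using hg U(1) by (meson homeomorphic_imp_open_map open_map_def)
  ultimately show ?thesis
    unfolding has_Baire_property_def by auto
qed

section \<open>Cylinders and the topology of sequence spaces\<close>

definition cylinder :: "nat \<Rightarrow> (nat \<Rightarrow> 'c) \<Rightarrow> (nat \<Rightarrow> 'c) set" where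
  "cylinder n s = {w. \<forall>i<n. w i = s i}"

lemma self_in_cylinder [simp]: "s \<in> cylinder n s"
  by (simp add: cylinder_def)

lemma cylinder_mono: "m \<le> n \<Longrightarrow> cylinder n s \<subseteq> cylinder m s"
  by (auto simp: cylinder_def)

lemma topspace_Baire_kappa: "topspace (Baire_kappa K) = {f. range f \<subseteq> K}"
  by (auto simp: Baire_kappa_def PiE_def Pi_def)

lemma topspace_Baire_kappa_UNIV [simp]: "topspace (Baire_kappa UNIV) = UNIV"
  by (simp add: topspace_Baire_kappa)

lemma continuous_map_Baire_kappa_proj: "continuous_map (Baire_kappa K) (discrete_topology K) (\<lambda>c. c n)"
  unfolding Baire_kappa_def by (rule continuous_map_product_projection) simp

lemma openin_cylinder: "openin (Baire_kappa UNIV) (cylinder n s)"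
proof -
  have "openin (Baire_kappa UNIV) (\<Pi>\<^sub>E i\<in>UNIV. if i < n then {s i} else UNIV)"
    unfolding Baire_kappa_def by (rule openin_PiE_gen[THEN iffD2]) auto
  also have "(\<Pi>\<^sub>E i\<in>UNIV. if i < n then {s i} else UNIV) = cylinder n s"
    by (auto simp: cylinder_def PiE_def Pi_def split: if_splits)
  finally show ?thesis .
qed

lemma openin_contains_cylinder:
  assumes "openin (Baire_kappa UNIV) U" "w \<in> U"
  obtains n where "cylinder n w \<subseteq> U"
proof -
  obtain V where V: "finite {i. V i \<noteq> UNIV}" "w \<in> (\<Pi>\<^sub>E i\<in>UNIV. V i)" "(\<Pi>\<^sub>E i\<in>UNIV. V i) \<subseteq> U"
    using assms unfolding Baire_kappa_def openin_product_topology_alt by auto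
  obtain n where n: "\<And>i. V i \<noteq> UNIV \<Longrightarrow> i < n"
    using finite_nat_set_iff_bounded[THEN iffD1, OF V(1)] by auto
  have "cylinder n w \<subseteq> (\<Pi>\<^sub>E i\<in>UNIV. V i)"
  proof
    fix v assume v: "v \<in> cylinder n w"
    have "v i \<in> V i" for i
      using v V(2) n[of i] by (cases "i < n") (auto simp: cylinder_def PiE_def Pi_def)
    then show "v \<in> (\<Pi>\<^sub>E i\<in>UNIV. V i)" by auto
  qed
  with V(3) show thesis
    using that by blast
qed

lemma completely_metrizable_Baire_kappa: "completely_metrizable_space (Baire_kappa K)"
  unfolding Baire_kappa_def completely_metrizable_space_product_topology
  by (simp add: completely_metrizable_space_discrete_topology)

lemma Polish_space_Baire_kappa: "Polish_space (Baire_kappa (UNIV :: 'c::finite set))"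
proof -
  \<comment> \<open>Sequences that are constantly \<open>undefined\<close> after a finite word: a
    countable set, since the alphabet is finite, and one that meets every cylinder.\<close>
  define e :: "'c list \<Rightarrow> nat \<Rightarrow> 'c" where "e l i = (if i < length l then l ! i else undefined)" for l i
  have "countable (range e)"
    using countable_lists[of "UNIV :: 'c set"] by (simp add: countable_finite)
  moreover have "Baire_kappa UNIV closure_of (range e) = UNIV"
  proof -
    have "\<exists>y\<in>range e. y \<in> T" if T: "openin (Baire_kappa UNIV) T" "w \<in> T" for w T
    proof -
      obtain n where n: "cylinder n w \<subseteq> T"
        using openin_contains_cylinder[OF T] by blast
      have "e (map w [0..<n]) \<in> cylinder n w"
        by (simp add: e_def cylinder_def)
      with n show ?thesis by blast
    qed
    then show ?thesis
      by (auto simp: in_closure_of)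
  qed
  ultimately show ?thesis
    unfolding Polish_space_def separable_space_def
    using completely_metrizable_Baire_kappa by (metis subset_UNIV topspace_Baire_kappa_UNIV)
qed

lemma homeomorphic_map_alter_coordinate:
  fixes \<pi> :: "'c \<Rightarrow> 'c"
  assumes "\<And>c. \<pi> (\<pi> c) = c"
  shows "homeomorphic_map (Baire_kappa UNIV) (Baire_kappa UNIV) (\<lambda>w. w(m := \<pi> (w m)))"
proof -
  let ?B = "Baire_kappa (UNIV :: 'c set)"
  have "continuous_map ?B (product_topology (\<lambda>_. discrete_topology UNIV) UNIV) (\<lambda>w. w(m := \<pi> (w m)))"
    unfolding continuous_map_componentwise_UNIV
  proof
    fix k
    have "continuous_map ?B (discrete_topology UNIV) (\<pi> \<circ> (\<lambda>w. w m))"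
      by (rule continuous_map_compose[OF continuous_map_Baire_kappa_proj]) simp
    then show "continuous_map ?B (discrete_topology UNIV) (\<lambda>w. (w(m := \<pi> (w m))) k)"
      using continuous_map_Baire_kappa_proj[of UNIV k] by (cases "k = m") (auto simp: comp_def)
  qed
  then have "continuous_map ?B ?B (\<lambda>w. w(m := \<pi> (w m)))"
    by (simp add: Baire_kappa_def)
  then have "homeomorphic_maps ?B ?B (\<lambda>w. w(m := \<pi> (w m))) (\<lambda>w. w(m := \<pi> (w m)))"
    by (simp add: homeomorphic_maps_def assms)
  then show ?thesis
    using homeomorphic_maps_map by blast
qed

text \<open>If the set were comeager in a cylinder, then, altering a coordinate beyond the cylinder,
  two comeager sets in that cylinder would be disjoint.\<close>

lemma meager_if_coordinate_alterations_leave: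
  fixes \<pi> :: "'c \<Rightarrow> 'c"
  assumes BP: "has_Baire_property (Baire_kappa UNIV) E"
    and \<pi>: "\<And>c. \<pi> (\<pi> c) = c" and E: "\<And>w n. w \<in> E \<Longrightarrow> w(n := \<pi> (w n)) \<notin> E"
  shows "meager_in (Baire_kappa UNIV) E"
proof -
  let ?B = "Baire_kappa (UNIV :: 'c set)"
  obtain U where U: "openin ?B U" and mU: "meager_in ?B (E \<union> U - E \<inter> U)"
    using BP unfolding has_Baire_property_def by blast
  obtain F where F: "countable F" "\<And>N. N \<in> F \<Longrightarrow> nowhere_dense_in ?B N" "E \<union> U - E \<inter> U \<subseteq> \<Union>F"
    using mU unfolding meager_in_def by blast
  show ?thesis
  proof (cases "U = {}")
    case True
    with mU show ?thesis by simp
  next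
    case False
    then obtain w0 where "w0 \<in> U" by blast
    then obtain m where m: "cylinder m w0 \<subseteq> U"
      using openin_contains_cylinder[OF U] by blast
    let ?\<phi> = "\<lambda>w. w(m := \<pi> (w m))"
    have \<phi>: "?\<phi> (?\<phi> w) = w" for w
      by (simp add: \<pi>)
    \<comment> \<open>As \<open>?\<phi>\<close> is its own inverse, avoiding the images of
      \<open>F\<close> under it keeps \<open>?\<phi> w\<close> outside \<open>F\<close>. Coordinate
      \<open>m\<close> is the first one that the cylinder leaves free, so \<open>w\<close> and
      \<open>?\<phi> w\<close> both stay in \<open>U\<close>.\<close>
    define \<G> where "\<G> = (\<lambda>N. ?B closure_of N) ` (F \<union> (`) ?\<phi> ` F)"
    have "nowhere_dense_in ?B N" if "N \<in> F \<union> (`) ?\<phi> ` F" for N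
      using that F(2) homeomorphic_map_nowhere_dense_in[OF homeomorphic_map_alter_coordinate[OF \<pi>]] by blast
    then have "?B interior_of \<Union>\<G> = {}"
      using completely_metrizable_Baire_kappa F(1)
      by (intro Baire_category_alt) (auto simp: \<G>_def nowhere_dense_in_def)
    then have "\<not> cylinder m w0 \<subseteq> \<Union>\<G>"
      using openin_cylinder[of m w0] interior_of_maximal[of "cylinder m w0" "\<Union>\<G>" ?B] self_in_cylinder[of w0 m]
      by blast
    then obtain w where w: "w \<in> cylinder m w0" "w \<notin> \<Union>\<G>" by blast
    have sub: "N \<subseteq> \<Union>\<G>" if "N \<in> F \<union> (`) ?\<phi> ` F" for N
      using that closure_of_subset[of N ?B] unfolding \<G>_def by fastforce
    have "w \<notin> \<Union>F"
      using sub w(2) by blast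
    moreover have "?\<phi> w \<notin> \<Union>F"
    proof
      assume "?\<phi> w \<in> \<Union>F"
      then obtain N where N: "N \<in> F" "?\<phi> w \<in> N" by blast
      then have "?\<phi> (?\<phi> w) \<in> ?\<phi> ` N" by (rule_tac imageI)
      then have "w \<in> ?\<phi> ` N" by (simp only: \<phi>)
      moreover have "?\<phi> ` N \<subseteq> \<Union>\<G>"
        using sub[of "?\<phi> ` N"] N(1) by blast
      ultimately show False
        using w(2) by blast
    qed
    moreover have "w \<in> U" "?\<phi> w \<in> U"
      using w(1) m by (auto simp: cylinder_def subset_iff)
    ultimately have "w \<in> E" "?\<phi> w \<in> E"
      using F(3) by blast+
    then show ?thesis
      using E by blast
  qed
qed

lemma nowhere_dense_avoids_cylinder:
  assumes "nowhere_dense_in (Baire_kappa UNIV) N"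
  obtains v n where "n \<ge> m" "v \<in> cylinder m s" "cylinder n v \<inter> N = {}"
proof -
  let ?B = "Baire_kappa (UNIV :: 'a set)"
  have "\<not> cylinder m s \<subseteq> ?B closure_of N"
    using assms openin_cylinder[of m s] interior_of_maximal[of "cylinder m s" "?B closure_of N" ?B] self_in_cylinder[of s m]
    unfolding nowhere_dense_in_def by blast
  then obtain v where v: "v \<in> cylinder m s" "v \<in> UNIV - ?B closure_of N" by blast
  have "openin ?B (UNIV - ?B closure_of N)"
    using openin_diff[OF openin_topspace closedin_closure_of, of ?B N] by simp
  then obtain n where "cylinder n v \<subseteq> UNIV - ?B closure_of N"
    using openin_contains_cylinder v(2) by blast
  moreover have "cylinder (max m n) v \<subseteq> cylinder n v"
    by (rule cylinder_mono) simp
  moreover have "N \<subseteq> ?B closure_of N"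
    by (rule closure_of_subset) simp
  ultimately have "cylinder (max m n) v \<inter> N = {}" by blast
  then show thesis
    using that v(1) by (metis max.cobounded1)
qed

text \<open>One block beginning at \<open>m\<close> serves all the given initial segments at once:
  it is lengthened for one pair after another, and lengthening preserves what was achieved for the
  earlier pairs.\<close>

lemma nowhere_dense_avoids_finitely_many_cylinders:
  fixes T :: "((nat \<Rightarrow> 'c) \<times> (nat \<Rightarrow> 'c) set) set"
  assumes "finite T" "\<And>s N. (s, N) \<in> T \<Longrightarrow> nowhere_dense_in (Baire_kappa UNIV) N"
  shows "\<exists>m'>m. \<exists>y. \<forall>(s, N)\<in>T. \<forall>w\<in>cylinder m s. (\<forall>i\<in>{m..<m'}. w i = y i) \<longrightarrow> w \<notin> N"
  using assms
proof (induction T)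
  case (insert p T)
  obtain s N where p: "p = (s, N)" by (cases p)
  obtain m1 y1 where m1: "m1 > m" and
    y1: "\<And>s N w. \<lbrakk>(s, N) \<in> T; w \<in> cylinder m s; \<forall>i\<in>{m..<m1}. w i = y1 i\<rbrakk> \<Longrightarrow> w \<notin> N"
    using insert.IH insert.prems by fast
  \<comment> \<open>The initial segment of the new pair followed by the block built so far; avoiding
    \<open>N\<close> inside this cylinder only extends the block.\<close>
  let ?s = "\<lambda>i. if i < m then s i else y1 i"
  have "nowhere_dense_in (Baire_kappa UNIV) N"
    using insert.prems p by blast
  then obtain v n where n: "n \<ge> m1" and v: "v \<in> cylinder m1 ?s" and dis: "cylinder n v \<inter> N = {}"
    by (rule nowhere_dense_avoids_cylinder)
  have "w \<notin> N'" if "(s', N') \<in> insert p T" "w \<in> cylinder m s'" "\<forall>i\<in>{m..<n}. w i = v i" for s' N' w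
  proof (cases "(s', N') = p")
    case True
    have "w i = v i" if "i < n" for i
      using \<open>w \<in> cylinder m s'\<close> \<open>\<forall>i\<in>{m..<n}. w i = v i\<close> v that m1 True p
      by (cases "i < m") (auto simp: cylinder_def)
    then have "w \<in> cylinder n v"
      by (simp add: cylinder_def)
    then show ?thesis
      using dis True p by blast
  next
    case False
    moreover have "w i = y1 i" if "i \<in> {m..<m1}" for i
      using \<open>\<forall>i\<in>{m..<n}. w i = v i\<close> v n that by (auto simp: cylinder_def)
    ultimately show ?thesis
      using y1 that by blast
  qed
  then show ?case
    using m1 n by (intro exI[of _ n] conjI exI[of _ v]) auto
qed (auto intro: exI[of _ "Suc m"])

text \<open>A combinatorial description of meager sets. Over a finite alphabet only finitely many
  words precede a block, so one pattern on block \<open>k\<close> excludes the nowhere dense sets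
  numbered up to \<open>k\<close> whatever came before. Meeting the patterns infinitely often
  excludes them all.\<close>

lemma meager_avoided_by_recurring_blocks:
  fixes E :: "(nat \<Rightarrow> 'c::finite) set"
  assumes "meager_in (Baire_kappa UNIV) E"
  obtains n :: "nat \<Rightarrow> nat" and y :: "nat \<Rightarrow> nat \<Rightarrow> 'c" where "strict_mono n"
    "\<And>w. infinite {k. \<forall>i\<in>{n k..<n (Suc k)}. w i = y k i} \<Longrightarrow> w \<notin> E"
proof -
  obtain F where F: "countable F" "\<And>N. N \<in> F \<Longrightarrow> nowhere_dense_in (Baire_kappa UNIV) N" "E \<subseteq> \<Union>F"
    using assms unfolding meager_in_def by blast
  \<comment> \<open>Adding the empty set makes the family nonempty, so that it can be
    enumerated.\<close>
  obtain N :: "nat \<Rightarrow> (nat \<Rightarrow> 'c) set" where N: "range N = insert {} F"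
    using range_from_nat_into[of "insert {} F"] F(1) by blast
  have nd: "nowhere_dense_in (Baire_kappa UNIV) (N j)" for j
  proof -
    have "N j \<in> insert {} F" using N by blast
    then show ?thesis
      using F(2) by (auto simp: nowhere_dense_in_def)
  qed
  define P where "P k m m' y \<longleftrightarrow> m' > m \<and> (\<forall>j\<le>k. \<forall>w. (\<forall>i\<in>{m..<m'}. w i = y i) \<longrightarrow> w \<notin> N j)"
    for k m m' :: nat and y :: "nat \<Rightarrow> 'c"
  have "\<exists>m' y. P k m m' y" for k m
  proof -
    \<comment> \<open>All words of length \<open>m\<close>, represented by functions restricted to
      the indices below \<open>m\<close>; a cylinder reads only those.\<close>
    let ?T = "(\<Pi>\<^sub>E i\<in>{..<m}. (UNIV :: 'c set)) \<times> N ` {..k}"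
    have "finite ?T"
      by (intro finite_cartesian_product finite_PiE) auto
    then obtain m' y where my: "m' > m"
      "\<forall>(s, N)\<in>?T. \<forall>w\<in>cylinder m s. (\<forall>i\<in>{m..<m'}. w i = y i) \<longrightarrow> w \<notin> N"
      using nowhere_dense_avoids_finitely_many_cylinders[of ?T m] nd by blast
    have "w \<notin> N j" if "j \<le> k" "\<forall>i\<in>{m..<m'}. w i = y i" for j w
    proof -
      have "(restrict w {..<m}, N j) \<in> ?T"
        using that by auto
      moreover have "w \<in> cylinder m (restrict w {..<m})"
        by (simp add: cylinder_def)
      ultimately show ?thesis
        using my(2) that(2) by blast
    qed
    then show ?thesis
      using my(1) unfolding P_def by blast
  qed
  then obtain M Y where "\<And>k m. P k m (M k m) (Y k m)"
    by metis
  then have M: "\<And>k m. M k m > m"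
    and Y: "\<And>k m j w. \<lbrakk>j \<le> k; \<forall>i\<in>{m..<M k m}. w i = Y k m i\<rbrakk> \<Longrightarrow> w \<notin> N j"
    unfolding P_def by blast+
  define n where "n = rec_nat 0 M"
  have n_Suc: "n (Suc k) = M k (n k)" for k
    by (simp add: n_def)
  show thesis
  proof (rule that[of n "\<lambda>k. Y k (n k)"])
    show "strict_mono n"
      unfolding strict_mono_Suc_iff n_Suc using M by blast
    fix w assume inf: "infinite {k. \<forall>i\<in>{n k..<n (Suc k)}. w i = Y k (n k) i}"
    have "w \<notin> N j" for j
    proof -
      obtain k where "k \<ge> j" "\<forall>i\<in>{n k..<n (Suc k)}. w i = Y k (n k) i"
        using inf unfolding infinite_nat_iff_unbounded_le by blast
      then show ?thesis
        using Y[of j k "n k" w] unfolding n_Suc by blast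
    qed
    then have "w \<notin> \<Union>(range N)" by blast
    then show "w \<notin> E"
      using N F(3) by auto
  qed
qed

text \<open>Number the blocks by pairs of finite bit strings.  On the block of the pair
  \<open>(u, v)\<close> the sequence attached to \<open>z\<close> follows the first or the second component of the pattern,
  according to whether \<open>z\<close> extends \<open>u\<close> or \<open>v\<close>; distinct \<open>z\<close>, \<open>z'\<close> then jointly
  realise the pattern on every block of a pair of initial segments that already differ.\<close>

lemma meager_relation_independent_family:
  fixes E :: "(nat \<Rightarrow> 'c::finite \<times> 'c) set"
  assumes "meager_in (Baire_kappa UNIV) E"
  shows "\<exists>\<alpha> :: (nat \<Rightarrow> bool) \<Rightarrow> nat \<Rightarrow> 'c. \<forall>z z'. z \<noteq> z' \<longrightarrow> (\<lambda>i. (\<alpha> z i, \<alpha> z' i)) \<notin> E"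
proof -
  obtain n y where n: "strict_mono n"
    and avoid: "\<And>w. infinite {k. \<forall>i\<in>{n k..<n (Suc k)}. w i = y k i} \<Longrightarrow> w \<notin> E"
    by (rule meager_avoided_by_recurring_blocks[OF assms]) (rule that)
  define b where "b i = (LEAST k. i < n (Suc k))" for i
  have b: "b i = k" if "i \<in> {n k..<n (Suc k)}" for i k
    unfolding b_def
  proof (rule Least_equality)
    fix k' assume "i < n (Suc k')"
    then have "n k < n (Suc k')" using that by simp
    then have "k < Suc k'" using n by (simp add: strict_mono_less)
    then show "k \<le> k'" by simp
  qed (use that in simp)
  define pre where "pre z m = map z [0..<m]" for z :: "nat \<Rightarrow> bool" and m
  \<comment> \<open>The else branch also serves sequences that extend neither \<open>u\<close> nor
    \<open>v\<close>; on such a block nothing is demanded of them.\<close>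
  define \<alpha> where "\<alpha> z i = (case from_nat (b i) :: bool list \<times> bool list of
      (u, v) \<Rightarrow> if pre z (length u) = u then fst (y (b i) i) else snd (y (b i) i))" for z i
  show ?thesis
  proof (intro exI[of _ \<alpha>] allI impI)
    fix z z' :: "nat \<Rightarrow> bool" assume "z \<noteq> z'"
    then obtain d where d: "z d \<noteq> z' d" by blast
    have pre_neq: "pre z m \<noteq> pre z' m" if "m > d" for m
      using that d by (auto simp: pre_def)
    let ?w = "\<lambda>i. (\<alpha> z i, \<alpha> z' i)"
    let ?k = "\<lambda>m. to_nat (pre z m, pre z' m)"
    have "inj ?k"
      by (rule injI) (metis from_nat_to_nat prod.inject pre_def length_map length_upt minus_nat.diff_0)
    then have "infinite (?k ` {d<..})"
      using finite_imageD[of ?k "{d<..}"] infinite_Ioi inj_on_subset by blast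
    moreover have "?k ` {d<..} \<subseteq> {k. \<forall>i\<in>{n k..<n (Suc k)}. ?w i = y k i}"
    proof (rule image_subsetI, rule CollectI, rule ballI)
      fix m i assume m: "m \<in> {d<..}" and "i \<in> {n (?k m)..<n (Suc (?k m))}"
      then have "b i = ?k m" by (intro b)
      moreover have "length (pre x m) = m" for x by (simp add: pre_def)
      ultimately show "?w i = y (?k m) i"
        using pre_neq[of m] m by (simp add: \<alpha>_def)
    qed
    ultimately have "infinite {k. \<forall>i\<in>{n k..<n (Suc k)}. ?w i = y k i}"
      by (metis (no_types, lifting) finite_subset)
    then show "?w \<notin> E"
      by (rule avoid[of ?w])
  qed
qed

section \<open>Suslin sets given by extension of maps\<close>

lemma closedin_Collect_all:
  assumes "\<And>i. closedin X {x \<in> topspace X. P i x}"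
  shows "closedin X {x \<in> topspace X. \<forall>i. P i x}"
proof -
  have "{x \<in> topspace X. \<forall>i. P i x} = (\<Inter>i. {x \<in> topspace X. P i x})"
    by auto
  then show ?thesis
    using closedin_INT[of UNIV X "\<lambda>i. {x \<in> topspace X. P i x}"] assms by simp
qed

lemma closedin_Collect_conj:
  assumes "closedin X {x \<in> topspace X. P x}" "closedin X {x \<in> topspace X. Q x}"
  shows "closedin X {x \<in> topspace X. P x \<and> Q x}"
proof -
  have "{x \<in> topspace X. P x \<and> Q x} = {x \<in> topspace X. P x} \<inter> {x \<in> topspace X. Q x}"
    by auto
  then show ?thesis
    using assms by auto
qed

text \<open>A premise that depends only on a discrete value defines a clopen set, so the implication
  is a union of two closed sets.\<close>

lemma closedin_Collect_imp_discrete: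
  assumes "continuous_map X (discrete_topology K) f" "closedin X {x \<in> topspace X. P x}"
  shows "closedin X {x \<in> topspace X. R (f x) \<longrightarrow> P x}"
proof -
  have "closedin X {x \<in> topspace X. f x \<in> {k \<in> K. \<not> R k}}"
    by (rule closedin_continuous_map_preimage[OF assms(1)]) auto
  moreover have "{x \<in> topspace X. R (f x) \<longrightarrow> P x} =
      {x \<in> topspace X. f x \<in> {k \<in> K. \<not> R k}} \<union> {x \<in> topspace X. P x}"
    using assms(1) by (auto simp: continuous_map_def Pi_iff)
  ultimately show ?thesis
    using assms(2) by auto
qed

lemma closedin_Collect_dist_le:
  fixes f g :: "'a \<Rightarrow> 'b::metric_space"
  assumes "continuous_map X euclidean f" "continuous_map X euclidean g"
  shows "closedin X {x \<in> topspace X. dist (f x) (g x) \<le> r}"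
proof -
  have "continuous_map X (prod_topology euclidean euclidean) (\<lambda>x. (f x, g x))"
    using assms by (intro continuous_map_pairedI)
  moreover have "continuous_map euclidean euclideanreal (\<lambda>p :: 'b \<times> 'b. dist (fst p) (snd p))"
    by (auto intro!: continuous_intros)
  ultimately have "continuous_map X euclideanreal ((\<lambda>p. dist (fst p) (snd p)) \<circ> (\<lambda>x. (f x, g x)))"
    unfolding prod_topology_euclidean by (rule continuous_map_compose)
  then have "closedin X {x \<in> topspace X. ((\<lambda>p. dist (fst p) (snd p)) \<circ> (\<lambda>x. (f x, g x))) x \<in> {..r}}"
    by (rule closedin_continuous_map_preimage) simp
  then show ?thesis by simp
qed

text \<open>An element \<open>c\<close> of \<open>\<kappa>\<^sup>\<nat>\<close> codes a map \<open>H\<close> on \<open>Q\<close>: the entry at \<open>prod_encode (Suc j, l)\<close> is a point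
  of the dense set within \<open>1 / (l + 1)\<close> of \<open>H (q j)\<close>, and the entry at \<open>prod_encode (0, m)\<close> is a modulus of
  continuity for the error \<open>1 / (m + 1)\<close>.  Each condition involves only finitely many entries of \<open>c\<close>,
  hence is closed.\<close>

lemma kappa_Suslin_extension:
  fixes S :: "'e::complete_space set" and Z :: "'z topology" and q :: "nat \<Rightarrow> 'q::metric_space"
    and K :: "'k set"
  assumes K: "infinite K" and S: "closed S" "S \<subseteq> closure D" "D \<subseteq> S" "D \<noteq> {}" "D \<lesssim> K"
    and Q: "compact Q" "range q \<subseteq> Q" "Q \<subseteq> closure (range q)"
    and b: "\<And>j. j \<in> B \<Longrightarrow> continuous_map Z euclidean (\<lambda>z. b z j)"
  shows "kappa_Suslin K Z {z \<in> topspace Z. \<exists>H. continuous_on Q H \<and> H ` Q \<subseteq> S \<and> (\<forall>j\<in>B. H (q j) = b z j)}"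
    (is "kappa_Suslin K Z ?A")
proof -
  let ?BK = "Baire_kappa K"
  obtain e0 where e0: "D \<subseteq> e0 ` K"
    using S(5) unfolding lepoll_iff by blast
  obtain d0 where d0: "d0 \<in> D"
    using S(4) by blast
  \<comment> \<open>Sending stray values to \<open>d0\<close> gives every entry of a code a meaning
    in \<open>D\<close>, so that limits of decoded entries always lie in \<open>S\<close>.\<close>
  define e where "e k = (if e0 k \<in> D then e0 k else d0)" for k
  have eD: "e k \<in> D" for k
    using d0 by (simp add: e_def)
  have eS: "e k \<in> S" for k
    using eD S(3) by blast
  have esurj: "\<exists>k\<in>K. e k = y" if "y \<in> D" for y
    using e0 that by (force simp: e_def image_iff)
  have "(UNIV :: nat set) \<lesssim> K"
    using K infinite_le_lepoll by blast
  then obtain \<nu> :: "'k \<Rightarrow> nat" where \<nu>: "\<And>m. \<exists>k\<in>K. \<nu> k = m"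
    unfolding lepoll_iff by (metis UNIV_I image_iff subsetD)
  define a where "a c j l = e (c (prod_encode (Suc j, l)))" for c :: "nat \<Rightarrow> 'k" and j l
  define M where "M c m = \<nu> (c (prod_encode (0, m)))" for c :: "nat \<Rightarrow> 'k" and m
  \<comment> \<open>\<open>PA\<close> to \<open>PC\<close> follow from the triangle inequality when
    the entries approximate a continuous \<open>H\<close>, and in the limit they recover one. In
    \<open>PB\<close> the term \<open>1 / Suc m\<close> is the error governed by the modulus and
    \<open>2 / Suc l\<close> stands for two approximation errors. Only \<open>PC\<close> involves
    \<open>z\<close>; being non-strict, it is closed in \<open>z\<close>.\<close>
  define PA where "PA = (\<lambda>c. \<forall>j l l'. dist (a c j l) (a c j l') \<le> 1 / Suc l + 1 / Suc l')"
  define PB where "PB = (\<lambda>c. \<forall>m i j l. dist (q i) (q j) < 1 / Suc (M c m) \<longrightarrow>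
                      dist (a c i l) (a c j l) \<le> 1 / Suc m + 2 / Suc l)"
  define PC where "PC = (\<lambda>z c. \<forall>j l. j \<in> B \<longrightarrow> dist (a c j l) (b z j) \<le> 1 / Suc l)"
  define C where "C = {p \<in> topspace (prod_topology Z ?BK). PA (snd p) \<and> PB (snd p) \<and> PC (fst p) (snd p)}"
  have coord: "continuous_map (prod_topology Z ?BK) (discrete_topology K) (\<lambda>p. snd p n)" for n
  proof -
    have "continuous_map ?BK (discrete_topology K) (\<lambda>c. c n)"
      unfolding Baire_kappa_def by (rule continuous_map_product_projection) simp
    from continuous_map_compose[OF continuous_map_snd this] show ?thesis
      by (simp add: comp_def)
  qed
  have ca: "continuous_map (prod_topology Z ?BK) euclidean (\<lambda>p. a (snd p) j l)" for j l
  proof -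
    have "continuous_map (prod_topology Z ?BK) euclidean (e \<circ> (\<lambda>p. snd p (prod_encode (Suc j, l))))"
      by (rule continuous_map_compose[OF coord]) simp
    then show ?thesis by (simp add: a_def comp_def)
  qed
  have cb: "continuous_map (prod_topology Z ?BK) euclidean (\<lambda>p. b (fst p) j)" if "j \<in> B" for j
    using continuous_map_compose[OF continuous_map_fst b[OF that]] by (simp add: comp_def)
  have "closedin (prod_topology Z ?BK) C"
    unfolding C_def PA_def PB_def PC_def
  proof (intro closedin_Collect_conj closedin_Collect_all)
    fix j l l'
    show "closedin (prod_topology Z ?BK) {p \<in> topspace (prod_topology Z ?BK).
             dist (a (snd p) j l) (a (snd p) j l') \<le> 1 / Suc l + 1 / Suc l'}"
      by (intro closedin_Collect_dist_le ca)
  next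
    fix m i j l
    show "closedin (prod_topology Z ?BK) {p \<in> topspace (prod_topology Z ?BK).
             dist (q i) (q j) < 1 / Suc (M (snd p) m) \<longrightarrow> dist (a (snd p) i l) (a (snd p) j l) \<le> 1 / Suc m + 2 / Suc l}"
      unfolding M_def
      by (rule closedin_Collect_imp_discrete[OF coord, where R = "\<lambda>k. dist (q i) (q j) < 1 / Suc (\<nu> k)"])
        (intro closedin_Collect_dist_le ca)
  next
    fix j l
    show "closedin (prod_topology Z ?BK) {p \<in> topspace (prod_topology Z ?BK).
            j \<in> B \<longrightarrow> dist (a (snd p) j l) (b (fst p) j) \<le> 1 / Suc l}"
    proof (cases "j \<in> B")
      case True
      then show ?thesis
        using closedin_Collect_dist_le[OF ca cb[OF True]] by simp
    next
      case False
      then show ?thesis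
        using closedin_topspace[of "prod_topology Z ?BK"] by (simp only: simp_thms Collect_mem_eq)
    qed
  qed
  moreover have "fst ` C = ?A"
  proof (intro equalityI subsetI)
    fix z assume "z \<in> fst ` C"
    then obtain c where z: "z \<in> topspace Z" and A: "PA c" and Bc: "PB c" and Cc: "PC z c"
      by (auto simp: C_def)
    have inv0: "(\<lambda>l. 1 / real (Suc l)) \<longlonglongrightarrow> 0"
      using LIMSEQ_inverse_real_of_nat by (simp add: inverse_eq_divide)
    have "Cauchy (a c j)" for j
    proof (rule metric_CauchyI)
      fix r :: real assume "r > 0"
      then obtain N where N: "1 / real (Suc N) < r / 2"
        using reals_Archimedean[of "r/2"] by (auto simp: inverse_eq_divide)
      have "dist (a c j l) (a c j l') < r" if "l \<ge> N" "l' \<ge> N" for l l'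
      proof -
        have "1 / real (Suc l) \<le> 1 / real (Suc N)" "1 / real (Suc l') \<le> 1 / real (Suc N)"
          using that by (simp_all add: frac_le)
        then show ?thesis
          using A N unfolding PA_def by (smt (verit) field_sum_of_halves)
      qed
      then show "\<exists>N. \<forall>l\<ge>N. \<forall>l'\<ge>N. dist (a c j l) (a c j l') < r"
        by blast
    qed
    then have "\<forall>j. \<exists>x. a c j \<longlonglongrightarrow> x"
      by (auto simp: Cauchy_convergent_iff convergent_def)
    then obtain h where h: "\<And>j. a c j \<longlonglongrightarrow> h j"
      by metis
    have hS: "h j \<in> S" for j
      using closed_sequentially[OF S(1) _ h] eS by (simp add: a_def)
    have hB: "dist (h i) (h j) \<le> 1 / Suc m" if "dist (q i) (q j) < 1 / Suc (M c m)" for i j m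
    proof (rule LIMSEQ_le)
      show "(\<lambda>l. dist (a c i l) (a c j l)) \<longlonglongrightarrow> dist (h i) (h j)"
        by (intro tendsto_dist h)
      show "(\<lambda>l. 1 / Suc m + 2 * (1 / real (Suc l))) \<longlonglongrightarrow> 1 / Suc m"
        using tendsto_add[OF tendsto_const[of "1 / Suc m"] tendsto_mult[OF tendsto_const[of 2] inv0]] by simp
      show "\<exists>N. \<forall>l\<ge>N. dist (a c i l) (a c j l) \<le> 1 / Suc m + 2 * (1 / real (Suc l))"
        using Bc that unfolding PB_def by (auto intro!: exI[of _ 0])
    qed
    \<comment> \<open>The enumeration \<open>q\<close> may repeat points. The modulus condition,
      applied to indices at distance 0, shows that the limit depends only on the point.\<close>
    have heq: "h i = h j" if "q i = q j" for i j
    proof -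
      have "dist (h i) (h j) \<le> 1 / Suc m" for m
        by (rule hB) (simp add: that)
      then have "dist (h i) (h j) \<le> 0"
        by (intro LIMSEQ_le_const[OF inv0]) auto
      then show ?thesis by simp
    qed
    define f where "f x = h (SOME j. q j = x)" for x
    have f: "f (q j) = h j" for j
      unfolding f_def by (rule heq) (rule someI, rule refl)
    have "uniformly_continuous_on (range q) f"
      unfolding uniformly_continuous_on_def
    proof (intro allI impI)
      fix r :: real assume "r > 0"
      then obtain m where m: "1 / real (Suc m) < r"
        using reals_Archimedean[of r] by (auto simp: inverse_eq_divide)
      have "dist (f x') (f x) < r" if "x \<in> range q" "x' \<in> range q" "dist x' x < 1 / Suc (M c m)" for x x'
        using that f hB m by (fastforce intro: le_less_trans)
      then show "\<exists>d>0. \<forall>x\<in>range q. \<forall>x'\<in>range q. dist x' x < d \<longrightarrow> dist (f x') (f x) < r"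
        by (intro exI[of _ "1 / Suc (M c m)"]) auto
    qed
    then obtain H where H: "uniformly_continuous_on (closure (range q)) H" "\<And>x. x \<in> range q \<Longrightarrow> f x = H x"
      by (rule uniformly_continuous_on_extension_on_closure) blast
    have cH: "continuous_on (closure (range q)) H"
      by (rule uniformly_continuous_imp_continuous[OF H(1)])
    have Hq: "H (q j) = h j" for j
      using H(2)[of "q j"] f by simp
    have "H ` closure (range q) \<subseteq> S"
      by (rule image_closure_subset[OF cH S(1)]) (auto simp: Hq hS)
    moreover have "H (q j) = b z j" if "j \<in> B" for j
    proof -
      have "(\<lambda>l. dist (a c j l) (b z j)) \<longlonglongrightarrow> 0"
        by (rule tendsto_sandwich[OF always_eventually always_eventually tendsto_const inv0])
          (use Cc that in \<open>auto simp: PC_def simp del: of_nat_Suc\<close>)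
      then have "a c j \<longlonglongrightarrow> b z j"
        by (rule tendsto_dist_iff[THEN iffD2])
      then show ?thesis
        using LIMSEQ_unique[OF h] Hq by simp
    qed
    ultimately show "z \<in> ?A"
      using z Q(3) continuous_on_subset[OF cH Q(3)] by blast
  next
    fix z assume "z \<in> ?A"
    then obtain H where z: "z \<in> topspace Z" and H: "continuous_on Q H" "H ` Q \<subseteq> S"
      and Hb: "\<And>j. j \<in> B \<Longrightarrow> H (q j) = b z j"
      by blast
    have "uniformly_continuous_on Q H"
      using H(1) Q(1) by (rule compact_uniformly_continuous)
    have "\<exists>k\<in>K. \<forall>x\<in>Q. \<forall>y\<in>Q. dist x y < 1 / Suc (\<nu> k) \<longrightarrow> dist (H x) (H y) < 1 / Suc m" for m
    proof -
      obtain \<delta> where \<delta>: "\<delta> > 0" "\<And>x y. \<lbrakk>x \<in> Q; y \<in> Q; dist y x < \<delta>\<rbrakk> \<Longrightarrow> dist (H y) (H x) < 1 / Suc m"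
        by (rule uniformly_continuous_onE[OF \<open>uniformly_continuous_on Q H\<close>, of "1 / Suc m"]) auto
      obtain N where N: "1 / real (Suc N) < \<delta>"
        using reals_Archimedean[OF \<delta>(1)] by (auto simp: inverse_eq_divide)
      obtain k where "k \<in> K" "\<nu> k = N"
        using \<nu> by blast
      then show ?thesis
        using \<delta>(2) N by (intro bexI[of _ k]) (auto simp: dist_commute)
    qed
    then obtain mk where mk: "\<And>m. mk m \<in> K"
      "\<And>m x y. \<lbrakk>x \<in> Q; y \<in> Q; dist x y < 1 / Suc (\<nu> (mk m))\<rbrakk> \<Longrightarrow> dist (H x) (H y) < 1 / Suc m"
      by metis
    have "\<exists>k\<in>K. dist (e k) (H (q j)) < 1 / Suc l" for j l
    proof -
      have "H (q j) \<in> closure D"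
        using Q(2) H(2) S(2) by blast
      then obtain y where "y \<in> D" "dist y (H (q j)) < 1 / Suc l"
        using closure_approachable[of "H (q j)" D] by (metis of_nat_0_less_iff zero_less_Suc zero_less_divide_1_iff)
      then show ?thesis
        using esurj by blast
    qed
    then obtain pk where pk: "\<And>j l. pk j l \<in> K" "\<And>j l. dist (e (pk j l)) (H (q j)) < 1 / Suc l"
      by metis
    define c where "c i = (case prod_decode i of (0, m) \<Rightarrow> mk m | (Suc j, l) \<Rightarrow> pk j l)" for i
    have cK: "c i \<in> K" for i
      unfolding c_def using mk(1) pk(1) by (auto split: prod.split nat.split)
    have M: "M c m = \<nu> (mk m)" and a: "a c j l = e (pk j l)" for m j l
      by (simp_all add: M_def a_def c_def)
    have qQ: "q j \<in> Q" for j
      using Q(2) by blast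
    have "PA c"
      unfolding PA_def a
    proof (intro allI)
      fix j l l'
      show "dist (e (pk j l)) (e (pk j l')) \<le> 1 / Suc l + 1 / Suc l'"
        using pk(2)[of j l] pk(2)[of j l'] dist_triangle2[of "e (pk j l)" "e (pk j l')" "H (q j)"] by linarith
    qed
    moreover have "PB c"
      unfolding PB_def a M
    proof (intro allI impI)
      fix m i j l assume "dist (q i) (q j) < 1 / Suc (\<nu> (mk m))"
      then have "dist (H (q i)) (H (q j)) < 1 / Suc m"
        by (intro mk(2) qQ)
      moreover have "dist (e (pk i l)) (e (pk j l)) \<le>
          dist (e (pk i l)) (H (q i)) + (dist (H (q i)) (H (q j)) + dist (e (pk j l)) (H (q j)))"
        using dist_triangle[of "e (pk i l)" "e (pk j l)" "H (q i)"]
          dist_triangle2[of "H (q i)" "e (pk j l)" "H (q j)"] by linarith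
      moreover have "2 / real (Suc l) = 1 / Suc l + 1 / Suc l"
        by simp
      ultimately show "dist (e (pk i l)) (e (pk j l)) \<le> 1 / Suc m + 2 / Suc l"
        using pk(2)[of i l] pk(2)[of j l] by linarith
    qed
    moreover have "PC z c"
      unfolding PC_def a using pk(2) Hb by (metis less_imp_le)
    ultimately have "(z, c) \<in> C"
      using z cK by (auto simp: C_def Baire_kappa_def PiE_def Pi_def)
    then show "z \<in> fst ` C" by force
  qed
  ultimately show ?thesis
    unfolding kappa_Suslin_def by blast
qed

section \<open>Essential loops in every neighbourhood of a point\<close>

text \<open>Loops that are not selected are replaced by constant ones rather than dropped. The
  schedule is then the same for all selections, and each time reads a single bit.\<close>

definition subconcat :: "(nat \<Rightarrow> real \<Rightarrow> 'a) \<Rightarrow> 'a \<Rightarrow> (nat \<Rightarrow> bool) \<Rightarrow> real \<Rightarrow> 'a" where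
  "subconcat g x \<alpha> = infinite_concat (\<lambda>n. if \<alpha> n then g n else (\<lambda>_. x)) x"

lemma null_loops_select:
  assumes "null_loops S x g"
  shows "null_loops S x (\<lambda>n. if \<alpha> n then g n else (\<lambda>_. x))"
proof -
  note g = null_loopsD[OF assms]
  have x: "x \<in> S"
    using g(2)[of 0] g(5)[of 0] by (auto simp: path_image_def)
  have "\<exists>N. \<forall>n\<ge>N. path_image (if \<alpha> n then g n else (\<lambda>_. x)) \<subseteq> ball x e" if e: "e > 0" for e
  proof -
    obtain N where "\<forall>n\<ge>N. path_image (g n) \<subseteq> ball x e"
      using assms e unfolding null_loops_def by meson
    then show ?thesis
      using e by (intro exI[of _ N]) (auto simp: path_image_def)
  qed
  moreover have "path (if \<alpha> n then g n else (\<lambda>_. x)) \<and> path_image (if \<alpha> n then g n else (\<lambda>_. x)) \<subseteq> S \<and>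
      pathstart (if \<alpha> n then g n else (\<lambda>_. x)) = x \<and> pathfinish (if \<alpha> n then g n else (\<lambda>_. x)) = x" for n
    using g[of n] x by (auto simp: path_def path_image_def pathstart_def pathfinish_def)
  ultimately show ?thesis
    unfolding null_loops_def by blast
qed

lemma subconcat_loop:
  assumes "null_loops S x g"
  shows "path (subconcat g x \<alpha>)" "path_image (subconcat g x \<alpha>) \<subseteq> S"
    "pathstart (subconcat g x \<alpha>) = x" "pathfinish (subconcat g x \<alpha>) = x"
  using path_infinite_concat[OF null_loops_select[OF assms]] infinite_concat_loop[OF null_loops_select[OF assms]]
  by (simp_all add: subconcat_def)

lemma subconcat_ends:
  assumes "null_loops S x g"
  shows "subconcat g x \<alpha> 0 = x" "subconcat g x \<alpha> 1 = x"
  using subconcat_loop(3,4)[OF assms] by (simp_all add: pathstart_def pathfinish_def)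

text \<open>For fixed \<open>t\<close> the value depends on one letter of \<open>w\<close>, whose
  index is determined by \<open>t\<close>; at t = 1 it is constant.\<close>

lemma continuous_map_subconcat:
  fixes \<pi> :: "'c \<Rightarrow> bool" and x :: "'a::metric_space"
  assumes t: "t \<in> {0..1}"
  shows "continuous_map (Baire_kappa UNIV) euclidean (\<lambda>w. subconcat g x (\<lambda>n. \<pi> (w n)) t)"
proof (cases "t = 1")
  case True
  then show ?thesis
    by (simp add: subconcat_def infinite_concat_1)
next
  case False
  then have "0 \<le> t" "t < 1"
    using t by auto
  from infinite_concat_local[OF this]
  obtain n s where ns: "s \<in> {0..1} \<and> (\<forall>h (x::'a). infinite_concat h x t = h n s)"
    by (elim exE) (rule that)
  then have "subconcat g x (\<lambda>n. \<pi> (w n)) t = (if \<pi> (w n) then g n s else x)" for w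
    by (simp add: subconcat_def)
  moreover have "continuous_map (Baire_kappa UNIV) euclidean ((\<lambda>c. if \<pi> c then g n s else x) \<circ> (\<lambda>w. w n))"
    by (rule continuous_map_compose[OF continuous_map_Baire_kappa_proj]) simp
  ultimately show ?thesis
    by (simp add: comp_def)
qed

text \<open>A homotopy of paths is a map on the square with prescribed boundary values, so this is
  an extension problem. Prescribing the values at rational boundary points suffices, and there they
  depend continuously on \<open>w\<close>.\<close>

lemma homotopic_subconcat_kappa_Suslin:
  fixes S :: "'a::{real_normed_vector, complete_space} set" and K :: "'k set"
  assumes K: "infinite K" and S: "closed S" "S \<subseteq> closure D" "D \<subseteq> S" "D \<noteq> {}" "D \<lesssim> K"
    and g: "null_loops S x g"
  shows "kappa_Suslin K (Baire_kappa UNIV)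
    {w. homotopic_paths S (subconcat g x (\<lambda>n. fst (w n))) (subconcat g x (\<lambda>n. snd (w n)))}"
proof -
  let ?I = "{0..1::real}" and ?R = "\<rat> \<inter> {0..1::real}"
  define q where "q = from_nat_into (?R \<times> ?R)"
  have R01: "0 \<in> ?R" "1 \<in> ?R" by auto
  have "countable (?R \<times> ?R)" "?R \<times> ?R \<noteq> {}"
    using countable_rat R01 by blast+
  then have q: "range q = ?R \<times> ?R"
    unfolding q_def by (rule range_from_nat_into[rotated])
  define B where "B = {j. fst (q j) \<in> {0, 1} \<or> snd (q j) \<in> {0, 1}}"
  \<comment> \<open>The two loops sit on the edges where the first coordinate is 0 or 1, the base
    point on the other two. The data match at the corners because the loops start and end at
    \<open>x\<close>.\<close>
  define b where "b w j = (if fst (q j) = 0 then subconcat g x (\<lambda>n. fst (w n)) (snd (q j))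
       else if fst (q j) = 1 then subconcat g x (\<lambda>n. snd (w n)) (snd (q j)) else x)"
    for w :: "nat \<Rightarrow> bool \<times> bool" and j
  have qI: "q j \<in> ?R \<times> ?R" for j
    using q by blast
  have qI': "fst (q j) \<in> ?I" "snd (q j) \<in> ?I" for j
    using qI[of j] by (auto simp: mem_Times_iff)
  have "kappa_Suslin K (Baire_kappa UNIV) {w \<in> topspace (Baire_kappa UNIV).
          \<exists>H. continuous_on (?I \<times> ?I) H \<and> H ` (?I \<times> ?I) \<subseteq> S \<and> (\<forall>j\<in>B. H (q j) = b w j)}"
  proof (rule kappa_Suslin_extension[OF K S])
    show "range q \<subseteq> ?I \<times> ?I"
      unfolding q by auto
    show "?I \<times> ?I \<subseteq> closure (range q)"
      unfolding q closure_Times closure_Rats_unit_interval by simp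
    show "continuous_map (Baire_kappa UNIV) euclidean (\<lambda>w. b w j)" for j
      using continuous_map_subconcat[of "snd (q j)" g x fst] continuous_map_subconcat[of "snd (q j)" g x snd] qI'[of j]
      by (cases "fst (q j) = 0"; cases "fst (q j) = 1") (simp_all add: b_def)
  qed (simp add: compact_Times)
  moreover have "(\<exists>H. continuous_on (?I \<times> ?I) H \<and> H ` (?I \<times> ?I) \<subseteq> S \<and> (\<forall>j\<in>B. H (q j) = b w j)) \<longleftrightarrow>
     homotopic_paths S (subconcat g x (\<lambda>n. fst (w n))) (subconcat g x (\<lambda>n. snd (w n)))"
     (is "?L \<longleftrightarrow> homotopic_paths S ?f ?g") for w
  proof
    assume ?L
    then obtain H where H: "continuous_on (?I \<times> ?I) H" "H ` (?I \<times> ?I) \<subseteq> S" "\<And>j. j \<in> B \<Longrightarrow> H (q j) = b w j"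
      by blast
    have Hq: "H (s, t) = (if s = 0 then ?f t else if s = 1 then ?g t else x)"
      if "s \<in> ?R" "t \<in> ?R" "s \<in> {0, 1} \<or> t \<in> {0, 1}" for s t
    proof -
      have "(s, t) \<in> range q"
        unfolding q using that by blast
      then obtain j where j: "q j = (s, t)" by (metis imageE)
      with that have "j \<in> B" by (simp add: B_def)
      from H(3)[OF this] show ?thesis
        by (simp add: j b_def)
    qed
    have c1: "continuous_on ?I (\<lambda>t. H (s, t))" and c2: "continuous_on ?I (\<lambda>t. H (t, s))" if "s \<in> ?I" for s
      by (rule continuous_on_compose2[OF H(1)]; use that in \<open>auto intro!: continuous_intros\<close>)+
    have cfg: "continuous_on ?I ?f" "continuous_on ?I ?g"
      using subconcat_loop(1)[OF g] by (auto simp: path_def)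
    note ends = subconcat_ends[OF g]
    \<comment> \<open>From rational points to the whole edge: both sides are continuous along
      it.\<close>
    have "H (0, t) = ?f t" if "t \<in> ?I" for t
      by (rule continuous_on_eq_if_eq_Rats[OF c1[of 0] cfg(1) _ that]) (use Hq R01 in auto)
    moreover have "H (1, t) = ?g t" if "t \<in> ?I" for t
      by (rule continuous_on_eq_if_eq_Rats[OF c1[of 1] cfg(2) _ that]) (use Hq R01 in auto)
    moreover have "H (t, 0) = x" if "t \<in> ?I" for t
      by (rule continuous_on_eq_if_eq_Rats[OF c2[of 0] continuous_on_const _ that]) (use Hq R01 ends in auto)
    moreover have "H (t, 1) = x" if "t \<in> ?I" for t
      by (rule continuous_on_eq_if_eq_Rats[OF c2[of 1] continuous_on_const _ that]) (use Hq R01 ends in auto)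
    ultimately show "homotopic_paths S ?f ?g"
      unfolding homotopic_paths using H(1,2) subconcat_loop(3,4)[OF g]
      by (intro exI[of _ H]) (auto simp: pathstart_def pathfinish_def ends)
  next
    assume "homotopic_paths S ?f ?g"
    then obtain H where H: "continuous_on (?I \<times> ?I) H" "H \<in> ?I \<times> ?I \<rightarrow> S"
      "\<And>t. t \<in> ?I \<Longrightarrow> H (0, t) = ?f t" "\<And>t. t \<in> ?I \<Longrightarrow> H (1, t) = ?g t"
      and He: "\<And>t. t \<in> ?I \<Longrightarrow> pathstart (H \<circ> Pair t) = pathstart ?f \<and> pathfinish (H \<circ> Pair t) = pathfinish ?f"
      unfolding homotopic_paths by blast
    have ends: "H (t, 0) = x" "H (t, 1) = x" if "t \<in> ?I" for t
      using He[OF that] subconcat_ends[OF g] by (auto simp: pathstart_def pathfinish_def)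
    have "H (q j) = b w j" if "j \<in> B" for j
    proof -
      obtain s t where st: "q j = (s, t)" "s \<in> ?I" "t \<in> ?I"
        using qI'[of j] by (metis prod.collapse)
      show ?thesis
        using that st H(3,4) ends by (auto simp: B_def b_def)
    qed
    then show ?L
      using H(1,2) by (intro exI[of _ H]) auto
  qed
  ultimately show ?thesis
    by simp
qed

text \<open>If \<open>p\<close> and \<open>q\<close> are not homotopic, then closing both up by the same paths yields two loops
  that are not homotopic, so one of them is not null-homotopic.\<close>

lemma essential_loop_near:
  fixes S :: "'a::real_normed_vector set"
  assumes lpc: "locally path_connected S" and x: "x \<in> S" and "r > 0"
    and nt: "\<And>r. r > 0 \<Longrightarrow> \<not> trivial_in S (S \<inter> ball x r)"
  obtains l where "path l" "path_image l \<subseteq> S \<inter> ball x r" "pathstart l = x" "pathfinish l = x"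
    "\<not> homotopic_paths S l (\<lambda>_. x)"
proof -
  have "openin (top_of_set S) (S \<inter> ball x r)" "x \<in> S \<inter> ball x r"
    using x \<open>r > 0\<close> by auto
  then obtain V where V: "openin (top_of_set S) V" "path_connected V" "x \<in> V" "V \<subseteq> S \<inter> ball x r"
    using lpc unfolding locally_path_connected by metis
  \<comment> \<open>The two non-homotopic paths are taken inside a smaller ball contained in
    \<open>V\<close>, so that path connectedness of \<open>V\<close> joins their ends to
    \<open>x\<close> without leaving the ball of radius \<open>r\<close>.\<close>
  obtain r' where r': "r' > 0" "ball x r' \<inter> S \<subseteq> V"
    using V(1,3) unfolding openin_contains_ball by blast
  obtain p q where p: "path p" "path_image p \<subseteq> V" and q: "path q" "path_image q \<subseteq> V"
    and pq: "pathstart p = pathstart q" "pathfinish p = pathfinish q" "\<not> homotopic_paths S p q"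
    using nt[OF r'(1)] r'(2) unfolding trivial_in_def by blast
  have "pathstart p \<in> V" "pathfinish p \<in> V"
    using p pathstart_in_path_image pathfinish_in_path_image by blast+
  then obtain u v where u: "path u" "path_image u \<subseteq> V" "pathstart u = x" "pathfinish u = pathstart p"
    and v: "path v" "path_image v \<subseteq> V" "pathstart v = pathfinish p" "pathfinish v = x"
    using V(2,3) unfolding path_connected_def by metis
  have S: "path_image p \<subseteq> S" "path_image q \<subseteq> S" "path_image u \<subseteq> S" "path_image v \<subseteq> S"
    using p q u v V(4) by blast+
  have "\<not> homotopic_paths S (u +++ (p +++ v)) (u +++ (q +++ v))"
  proof
    assume "homotopic_paths S (u +++ (p +++ v)) (u +++ (q +++ v))"
    then have "homotopic_paths S (p +++ v) (q +++ v)"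
      by (rule homotopic_paths_cancel_left)
        (use p q pq u v S in \<open>auto simp: subset_path_image_join\<close>)
    then have "homotopic_paths S p q"
      by (rule homotopic_paths_cancel_right) (use p q pq v S in auto)
    then show False using pq by blast
  qed
  then have "\<not> homotopic_paths S (u +++ (p +++ v)) (\<lambda>_. x) \<or> \<not> homotopic_paths S (u +++ (q +++ v)) (\<lambda>_. x)"
    by (meson homotopic_paths_sym homotopic_paths_trans)
  moreover have "path_image (u +++ (p +++ v)) \<subseteq> S \<inter> ball x r" "path_image (u +++ (q +++ v)) \<subseteq> S \<inter> ball x r"
    by (intro subset_path_image_join order_trans[OF _ V(4)] p q u v)+
  ultimately show thesis
    using that[of "u +++ (p +++ v)"] that[of "u +++ (q +++ v)"] p q pq u v by auto
qed

lemma essential_null_loops: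
  fixes S :: "'a::real_normed_vector set"
  assumes lpc: "locally path_connected S" and x: "x \<in> S"
    and nt: "\<And>r. r > 0 \<Longrightarrow> \<not> trivial_in S (S \<inter> ball x r)"
  obtains g where "null_loops S x g" "\<And>n. \<not> homotopic_paths S (g n) (\<lambda>_. x)"
proof -
  have "\<exists>l. path l \<and> path_image l \<subseteq> S \<inter> ball x (1 / Suc n) \<and> pathstart l = x \<and> pathfinish l = x \<and>
      \<not> homotopic_paths S l (\<lambda>_. x)" for n
    by (rule essential_loop_near[OF lpc x _ nt, of "1 / Suc n"]) auto
  then obtain g where g: "\<And>n. path (g n) \<and> path_image (g n) \<subseteq> S \<inter> ball x (1 / Suc n) \<and> pathstart (g n) = x \<and>
      pathfinish (g n) = x \<and> \<not> homotopic_paths S (g n) (\<lambda>_. x)"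
    by metis
  have "\<exists>N. \<forall>n\<ge>N. path_image (g n) \<subseteq> ball x e" if e: "e > 0" for e
  proof -
    obtain N where N: "1 / real (Suc N) < e"
      using reals_Archimedean[OF e] by (auto simp: inverse_eq_divide)
    have "path_image (g n) \<subseteq> ball x e" if "n \<ge> N" for n
    proof -
      have "1 / real (Suc n) \<le> 1 / real (Suc N)"
        using that by (simp add: frac_le)
      then have "ball x (1 / Suc n) \<subseteq> ball x e"
        using N by (intro subset_ball) simp
      then show ?thesis
        using g[of n] by blast
    qed
    then show ?thesis by blast
  qed
  then have "null_loops S x g"
    using g unfolding null_loops_def by blast
  then show thesis
    using that g by blast
qed

lemma continuum_many_subconcat:
  fixes S :: "'a::{real_normed_vector, complete_space} set" and K :: "'k set"
  assumes K: "infinite K" "BP K" and S: "closed S" "S \<subseteq> closure D" "D \<subseteq> S" "D \<noteq> {}" "D \<lesssim> K"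
    and g: "null_loops S x g" and ess: "\<And>n. \<not> homotopic_paths S (g n) (\<lambda>_. x)"
  obtains \<alpha> :: "real \<Rightarrow> nat \<Rightarrow> bool"
  where "\<And>r s. homotopic_paths S (subconcat g x (\<alpha> r)) (subconcat g x (\<alpha> s)) \<Longrightarrow> r = s"
proof -
  define E :: "(nat \<Rightarrow> bool \<times> bool) set" where
    "E = {w. homotopic_paths S (subconcat g x (\<lambda>n. fst (w n))) (subconcat g x (\<lambda>n. snd (w n)))}"
  have "kappa_Suslin K (Baire_kappa UNIV) E"
    unfolding E_def by (rule homotopic_subconcat_kappa_Suslin[OF K(1) S g])
  moreover have "topspace (Baire_kappa (UNIV :: (bool \<times> bool) set)) \<lesssim> (UNIV :: real set)"
  proof -
    obtain \<iota> :: "bool \<times> bool \<Rightarrow> real" where "inj \<iota>"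
      using countableI_type[of "UNIV :: (bool \<times> bool) set"] by (metis countableE inj_compose inj_of_nat)
    then have "inj (\<lambda>w n. \<iota> (w n))"
      by (intro injI ext) (metis injD)
    then have "(UNIV :: (nat \<Rightarrow> bool \<times> bool) set) \<lesssim> (UNIV :: (nat \<Rightarrow> real) set)"
      unfolding lepoll_def by blast
    then show ?thesis
      using sequences_of_reals_lepoll lepoll_trans by auto
  qed
  ultimately have "has_Baire_property (Baire_kappa UNIV) E"
    using BP_has_Baire_property[OF K(2) Polish_space_Baire_kappa] by blast
  then have "meager_in (Baire_kappa UNIV) E"
  proof (rule meager_if_coordinate_alterations_leave[where \<pi> = "\<lambda>p. (\<not> fst p, snd p)"])
    fix w :: "nat \<Rightarrow> bool \<times> bool" and n assume w: "w \<in> E"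
    let ?w = "w(n := (\<not> fst (w n), snd (w n)))"
    show "?w \<notin> E"
    proof
      assume w': "?w \<in> E"
      let ?h = "\<lambda>i. if fst (w i) then g i else (\<lambda>_. x)"
      let ?h' = "\<lambda>i. if fst (?w i) then g i else (\<lambda>_. x)"
      have snd_w: "(\<lambda>i. snd (?w i)) = (\<lambda>i. snd (w i))" by auto
      \<comment> \<open>The second component is unchanged and links the two selections in the first
        component, which differ only at \<open>n\<close>.\<close>
      have "homotopic_paths S (subconcat g x (\<lambda>i. fst (w i))) (subconcat g x (\<lambda>i. snd (w i)))"
        using w by (simp only: E_def mem_Collect_eq)
      moreover have "homotopic_paths S (subconcat g x (\<lambda>i. snd (w i))) (subconcat g x (\<lambda>i. fst (?w i)))"
        using w' unfolding E_def mem_Collect_eq snd_w by (rule homotopic_paths_sym)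
      ultimately have "homotopic_paths S (infinite_concat ?h x) (infinite_concat ?h' x)"
        unfolding subconcat_def by (rule homotopic_paths_trans)
      then have "homotopic_paths S (?h n) (?h' n)"
        by (rule homotopic_factor_of_infinite_concat[OF null_loops_select[OF g] null_loops_select[OF g], rotated]) simp
      then have "homotopic_paths S (g n) (\<lambda>_. x)"
        by (cases "fst (w n)") (auto simp: homotopic_paths_sym)
      then show False
        using ess by blast
    qed
  qed simp
  define indep where "indep \<beta> \<longleftrightarrow> (\<forall>z z'. z \<noteq> z' \<longrightarrow> (\<lambda>i. (\<beta> z i, \<beta> z' i)) \<notin> E)"
    for \<beta> :: "(nat \<Rightarrow> bool) \<Rightarrow> nat \<Rightarrow> bool"
  have "\<exists>\<beta>. indep \<beta>"
    unfolding indep_def by (rule meager_relation_independent_family) fact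
  then obtain \<beta> where "indep \<beta>" ..
  then have \<beta>: "(\<lambda>i. (\<beta> z i, \<beta> z' i)) \<notin> E" if "z \<noteq> z'" for z z'
    using that by (simp add: indep_def)
  obtain c :: "real \<Rightarrow> nat set" where c: "inj c"
    using nat_sets_eqpoll_reals[THEN eqpoll_sym] unfolding eqpoll_def bij_betw_def by blast
  show thesis
  proof (rule that[of "\<lambda>r. \<beta> (\<lambda>n. n \<in> c r)"])
    fix r s
    assume "homotopic_paths S (subconcat g x (\<beta> (\<lambda>n. n \<in> c r))) (subconcat g x (\<beta> (\<lambda>n. n \<in> c s)))"
    then have "(\<lambda>i. (\<beta> (\<lambda>n. n \<in> c r) i, \<beta> (\<lambda>n. n \<in> c s) i)) \<in> E"
      by (simp add: E_def)
    then have "(\<lambda>n. n \<in> c r) = (\<lambda>n. n \<in> c s)"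
      using \<beta> by blast
    then have "c r = c s"
      by (metis Collect_mem_eq)
    then show "r = s"
      using c by (simp add: injD)
  qed
qed

text \<open>Both alternatives are phrased through maps on the loops themselves, which transfer along
  the homeomorphism to the quotient that defines the group of \<open>X\<close>.\<close>

lemma loops_dichotomy:
  fixes S :: "'a::{real_normed_vector, complete_space} set" and K :: "'k set"
  assumes K: "infinite K" "BP K" and S: "closed S" "S \<subseteq> closure D" "D \<subseteq> S" "D \<noteq> {}" "D \<lesssim> K"
    and conn: "connected S" and lpc: "locally path_connected S" and x0: "x0 \<in> S"
  defines "L \<equiv> {p. path p \<and> path_image p \<subseteq> S \<and> pathstart p = x0 \<and> pathfinish p = x0}"
  shows "(\<exists>\<phi>. \<phi> \<in> L \<rightarrow> K \<and> (\<forall>p\<in>L. \<forall>q\<in>L. \<phi> p = \<phi> q \<longrightarrow> homotopic_paths S p q)) \<or>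
         (\<exists>\<psi> :: real \<Rightarrow> real \<Rightarrow> 'a. range \<psi> \<subseteq> L \<and> (\<forall>r s. homotopic_paths S (\<psi> r) (\<psi> s) \<longrightarrow> r = s))"
proof (cases "\<forall>x\<in>S. \<exists>r>0. trivial_in S (S \<inter> ball x r)")
  case True
  have "\<exists>\<epsilon>>0. \<forall>h\<in>L. (\<forall>t\<in>{0..1}. dist (g t) (h t) < \<epsilon>) \<longrightarrow> homotopic_paths S g h" if g: "g \<in> L" for g
  proof -
    have g': "path g" "path_image g \<subseteq> S" "pathstart g = x0" "pathfinish g = x0"
      using g by (auto simp: L_def)
    obtain \<epsilon> where "\<epsilon> > 0"
      "\<And>h. \<lbrakk>path h; path_image h \<subseteq> S; pathstart h = pathstart g; pathfinish h = pathfinish g;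
          \<And>t. t \<in> {0..1} \<Longrightarrow> dist (g t) (h t) < \<epsilon>\<rbrakk> \<Longrightarrow> homotopic_paths S g h"
      by (rule close_paths_homotopic[OF lpc _ g'(1,2)]) (use True in blast)+
    then show ?thesis
      using g'(3,4) unfolding L_def by (intro exI[of _ \<epsilon>]) simp
  qed
  then obtain \<phi> where "\<phi> \<in> L \<rightarrow> K" "\<And>p q. \<lbrakk>p \<in> L; q \<in> L; \<phi> p = \<phi> q\<rbrakk> \<Longrightarrow> homotopic_paths S p q"
    using open_classes_of_paths_lepoll[OF K(1) S(2,5), of L "homotopic_paths S"] unfolding L_def by blast
  then show ?thesis by blast
next
  case False
  then obtain x where x: "x \<in> S" "\<And>r. r > 0 \<Longrightarrow> \<not> trivial_in S (S \<inter> ball x r)"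
    by blast
  obtain g where g: "null_loops S x g" "\<And>n. \<not> homotopic_paths S (g n) (\<lambda>_. x)"
    using essential_null_loops[OF lpc x] by blast
  obtain \<alpha> :: "real \<Rightarrow> nat \<Rightarrow> bool"
    where \<alpha>: "\<And>r s. homotopic_paths S (subconcat g x (\<alpha> r)) (subconcat g x (\<alpha> s)) \<Longrightarrow> r = s"
    using continuum_many_subconcat[OF K S g] by blast
  \<comment> \<open>The bad point need not be the base point; conjugation by a path between them is
    injective on homotopy classes.\<close>
  have "path_component S x0 x"
    using conn x0 x(1) unfolding path_component_eq_connected_component[OF lpc] connected_iff_connected_component
    by blast
  then obtain u where u: "path u" "path_image u \<subseteq> S" "pathstart u = x0" "pathfinish u = x"
    unfolding path_component_def by blast
  define \<psi> where "\<psi> r = u +++ (subconcat g x (\<alpha> r) +++ reversepath u)" for r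
  note f = subconcat_loop[OF g(1)]
  have "\<psi> r \<in> L" for r
    unfolding L_def \<psi>_def using u f by (auto simp: subset_path_image_join)
  moreover have "r = s" if "homotopic_paths S (\<psi> r) (\<psi> s)" for r s
  proof -
    have "homotopic_paths S (subconcat g x (\<alpha> r) +++ reversepath u) (subconcat g x (\<alpha> s) +++ reversepath u)"
      using that unfolding \<psi>_def
      by (rule homotopic_paths_cancel_left) (use u f in \<open>auto simp: subset_path_image_join\<close>)
    then have "homotopic_paths S (subconcat g x (\<alpha> r)) (subconcat g x (\<alpha> s))"
      by (rule homotopic_paths_cancel_right) (use u f in auto)
    then show ?thesis
      by (rule \<alpha>)
  qed
  ultimately show ?thesis
    by blast
qed

section \<open>The fundamental group\<close>

lemma quotient_lepoll:
  assumes R: "equiv A R" and "\<phi> \<in> A \<rightarrow> B" "\<And>p q. \<lbrakk>p \<in> A; q \<in> A; \<phi> p = \<phi> q\<rbrakk> \<Longrightarrow> (p, q) \<in> R"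
  shows "A // R \<lesssim> B"
proof -
  define rep where "rep C = (SOME p. p \<in> C)" for C :: "'a set"
  have rep: "rep C \<in> C" if "C \<in> A // R" for C
    using in_quotient_imp_non_empty[OF R that] unfolding rep_def by (simp add: some_in_eq)
  have repA: "rep C \<in> A" if "C \<in> A // R" for C
    using rep[OF that] in_quotient_imp_subset[OF R that] by blast
  have "inj_on (\<lambda>C. \<phi> (rep C)) (A // R)"
  proof (rule inj_onI)
    fix C C' assume C: "C \<in> A // R" "C' \<in> A // R" "\<phi> (rep C) = \<phi> (rep C')"
    then have "(rep C, rep C') \<in> R"
      by (intro assms(3) repA)
    then show "C = C'"
      using quotient_eq_iff[OF R C(1,2) rep[OF C(1)] rep[OF C(2)]] by simp
  qed
  moreover have "(\<lambda>C. \<phi> (rep C)) ` (A // R) \<subseteq> B"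
    using repA assms(2) by auto
  ultimately show ?thesis
    unfolding lepoll_def by blast
qed

lemma lepoll_quotient:
  fixes \<psi> :: "'b \<Rightarrow> 'a"
  assumes R: "equiv A R" and "range \<psi> \<subseteq> A" "\<And>r s. (\<psi> r, \<psi> s) \<in> R \<Longrightarrow> r = s"
  shows "(UNIV :: 'b set) \<lesssim> A // R"
proof -
  have "inj (\<lambda>r. R `` {\<psi> r})"
    using assms(2,3) eq_equiv_class[OF _ R] by (intro injI) blast
  moreover have "range (\<lambda>r. R `` {\<psi> r}) \<subseteq> A // R"
    using assms(2) by (auto intro!: quotientI)
  ultimately show ?thesis
    unfolding lepoll_def by blast
qed

lemma equiv_loop_homotopic: "equiv (loops_at X x0) (loop_homotopic X x0)"
proof (rule equivI)
  show "loop_homotopic X x0 \<subseteq> loops_at X x0 \<times> loops_at X x0"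
    by (auto simp: loop_homotopic_def)
  show "refl_on (loops_at X x0) (loop_homotopic X x0)"
    by (auto simp: refl_on_def loop_homotopic_def loops_at_def pathin_def)
  show "sym (loop_homotopic X x0)"
    by (auto simp: sym_def loop_homotopic_def intro: homotopic_with_symD)
  show "trans (loop_homotopic X x0)"
    by (auto simp: trans_def loop_homotopic_def intro: homotopic_with_trans)
qed

lemma locally_path_connected_if_space:
  assumes "locally_path_connected_space (top_of_set S)"
  shows "locally path_connected S"
  unfolding locally_path_connected
proof (intro allI impI)
  fix V x assume "openin (top_of_set S) V \<and> x \<in> V"
  then obtain U where "openin (top_of_set S) U" "path_connectedin (top_of_set S) U" "x \<in> U" "U \<subseteq> V"
    using assms unfolding locally_path_connected_space by blast
  then show "\<exists>U. openin (top_of_set S) U \<and> path_connected U \<and> x \<in> U \<and> U \<subseteq> V"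
    by (auto simp: path_connectedin_subtopology)
qed

theorem theorem4p1:
  fixes K :: "'k set" and X :: "'a topology" and x0 :: 'a
  assumes "infinite K"
    and "K \<lesssim> (UNIV :: real set)" and "\<not> (UNIV :: real set) \<lesssim> K"
    and "BP K"
    and "connected_space X" and "locally_path_connected_space X"
    and "kappa_Polish K X"
    and "x0 \<in> topspace X"
  shows "fundamental_group X x0 \<lesssim> K \<or> fundamental_group X x0 \<approx> (UNIV :: real set)"
proof -
  obtain S :: "('a discrete \<Rightarrow>\<^sub>C real) set" where S: "closed S" "X homeomorphic_space top_of_set S"
    using completely_metrizable_homeomorphic_closed_in_Banach assms(7) unfolding kappa_Polish_def by blast
  then obtain f k where fk: "homeomorphic_maps X (top_of_set S) f k"
    unfolding homeomorphic_space_def by blast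
  then have hf: "homeomorphic_map X (top_of_set S) f"
    using homeomorphic_maps_map by blast
  have cf: "continuous_map X (top_of_set S) f" and ck: "continuous_map (top_of_set S) X k"
    and kf: "\<And>x. x \<in> topspace X \<Longrightarrow> k (f x) = x" and fk': "\<And>y. y \<in> S \<Longrightarrow> f (k y) = y"
    using fk by (auto simp: homeomorphic_maps_def)
  have fS: "f x \<in> S" if "x \<in> topspace X" for x
    using cf that by (auto simp: continuous_map_def)
  obtain D where D: "D \<subseteq> topspace X" "X closure_of D = topspace X" "D \<lesssim> K"
    using assms(7) unfolding kappa_Polish_def kappa_separable_def by blast
  have "top_of_set S closure_of (f ` D) = f ` topspace X"
    using homeomorphic_map_closure_of[OF hf D(1)] D(2) by simp
  also have "\<dots> = S"
    using homeomorphic_imp_surjective_map[OF hf] by simp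
  finally have dense: "S \<subseteq> closure (f ` D)"
    using closure_of_subtopology_subset[of euclidean S "f ` D"] by simp
  have fD: "f ` D \<subseteq> S" "f ` D \<noteq> {}" "f ` D \<lesssim> K" "f ` D \<lesssim> (UNIV :: real set)"
  proof -
    show "f ` D \<subseteq> S" using D(1) fS by blast
    show "f ` D \<noteq> {}" using dense fS[OF assms(8)] by auto
    show K: "f ` D \<lesssim> K"
      using image_lepoll D(3) lepoll_trans by blast
    show "f ` D \<lesssim> (UNIV :: real set)"
      using lepoll_trans[OF K assms(2)] .
  qed
  have conn: "connected S"
    using homeomorphic_connected_space[OF S(2)] assms(5) by (simp add: connectedin_def flip: connectedin_iff_connected)
  have lpc: "locally path_connected S"
    using homeomorphic_locally_path_connected_space[OF S(2)] assms(6) locally_path_connected_if_space by blast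
  define L where "L = {p. path p \<and> path_image p \<subseteq> S \<and> pathstart p = f x0 \<and> pathfinish p = f x0}"
  let ?I = "top_of_set {0..1::real}"
  have L_iff: "p \<in> L \<longleftrightarrow> continuous_map ?I (top_of_set S) p \<and> p 0 = f x0 \<and> p 1 = f x0" for p
    by (auto simp: L_def path_def path_image_def pathstart_def pathfinish_def continuous_map_in_subtopology)
  have fL: "f \<circ> g \<in> L" if "g \<in> loops_at X x0" for g
    using that continuous_map_compose[OF _ cf, of ?I g] by (auto simp: L_iff loops_at_def pathin_def)
  have kL: "k \<circ> p \<in> loops_at X x0" if "p \<in> L" for p
    using that continuous_map_compose[OF _ ck, of ?I p] kf[OF assms(8)] by (auto simp: L_iff loops_at_def pathin_def)
  have to_X: "(g, h) \<in> loop_homotopic X x0"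
    if g: "g \<in> loops_at X x0" and h: "h \<in> loops_at X x0" and gh: "homotopic_paths S (f \<circ> g) (f \<circ> h)" for g h
  proof -
    have top: "g t \<in> topspace X \<and> h t \<in> topspace X" if "t \<in> {0..1}" for t
      using g h that by (auto simp: loops_at_def pathin_def continuous_map_def)
    have "homotopic_with (\<lambda>r. r 0 = x0 \<and> r 1 = x0) ?I X (k \<circ> (f \<circ> g)) (k \<circ> (f \<circ> h))"
      by (rule homotopic_with_compose_continuous_map_left[OF gh[unfolded homotopic_paths_def] ck])
        (use g kf[OF assms(8)] in \<open>auto simp: pathstart_def pathfinish_def loops_at_def\<close>)
    \<comment> \<open>\<open>k \<circ> f\<close> is the identity on the space only, and loops are
      functions on all reals; what they do outside the unit interval is disregarded here.\<close>
    then have "homotopic_with (\<lambda>r. r 0 = x0 \<and> r 1 = x0) ?I X g h"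
      by (rule homotopic_with_eq) (use top kf in auto)
    then show ?thesis
      using g h by (simp add: loop_homotopic_def)
  qed
  have from_X: "homotopic_paths S p q"
    if p: "p \<in> L" and q: "q \<in> L" and pq: "(k \<circ> p, k \<circ> q) \<in> loop_homotopic X x0" for p q
  proof -
    have inS: "p t \<in> S \<and> q t \<in> S" if "t \<in> {0..1}" for t
      using p q that by (auto simp: L_def path_image_def)
    have "homotopic_with (\<lambda>r. r 0 = x0 \<and> r 1 = x0) ?I X (k \<circ> p) (k \<circ> q)"
      using pq by (simp add: loop_homotopic_def)
    then have "homotopic_with (\<lambda>r. pathstart r = pathstart p \<and> pathfinish r = pathfinish p) ?I (top_of_set S)
        (f \<circ> (k \<circ> p)) (f \<circ> (k \<circ> q))"
      by (rule homotopic_with_compose_continuous_map_left[OF _ cf])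
        (use p in \<open>auto simp: L_def pathstart_def pathfinish_def\<close>)
    then show ?thesis
      unfolding homotopic_paths_def
      by (rule homotopic_with_eq) (use inS fk' in \<open>auto simp: pathstart_def pathfinish_def\<close>)
  qed
  note equiv = equiv_loop_homotopic[of X x0]
  obtain \<xi> :: "(real \<Rightarrow> ('a discrete \<Rightarrow>\<^sub>C real)) \<Rightarrow> real" where \<xi>:
    "\<And>g h t. \<lbrakk>path g; path_image g \<subseteq> S; path h; path_image h \<subseteq> S; \<xi> g = \<xi> h; t \<in> {0..1}\<rbrakk> \<Longrightarrow> g t = h t"
    by (rule paths_determined_by_real[OF dense fD(4)]) (rule that)
  have upper: "fundamental_group X x0 \<lesssim> (UNIV :: real set)"
    unfolding fundamental_group_def
  proof (rule quotient_lepoll[OF equiv, of "\<lambda>g. \<xi> (f \<circ> g)"])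
    fix g h assume gh: "g \<in> loops_at X x0" "h \<in> loops_at X x0" "\<xi> (f \<circ> g) = \<xi> (f \<circ> h)"
    \<comment> \<open>Equal codes give agreement on the unit interval, not equality of functions,
      but that already makes the paths homotopic.\<close>
    then have "homotopic_paths S (f \<circ> g) (f \<circ> h)"
      using fL[OF gh(1)] fL[OF gh(2)] \<xi> unfolding L_def by (intro homotopic_paths_eq) blast+
    then show "(g, h) \<in> loop_homotopic X x0"
      by (rule to_X[OF gh(1,2)])
  qed auto
  from loops_dichotomy[OF assms(1,4) S(1) dense fD(1-3) conn lpc fS[OF assms(8)], folded L_def]
  show ?thesis
  proof (elim disjE exE conjE)
    fix \<phi> assume \<phi>: "\<phi> \<in> L \<rightarrow> K" "\<forall>p\<in>L. \<forall>q\<in>L. \<phi> p = \<phi> q \<longrightarrow> homotopic_paths S p q"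
    have "fundamental_group X x0 \<lesssim> K"
      unfolding fundamental_group_def
      by (rule quotient_lepoll[OF equiv, of "\<lambda>g. \<phi> (f \<circ> g)"]) (use \<phi> fL to_X in auto)
    then show ?thesis ..
  next
    fix \<psi> :: "real \<Rightarrow> real \<Rightarrow> ('a discrete \<Rightarrow>\<^sub>C real)"
    assume \<psi>: "range \<psi> \<subseteq> L" "\<forall>r s. homotopic_paths S (\<psi> r) (\<psi> s) \<longrightarrow> r = s"
    have "(UNIV :: real set) \<lesssim> fundamental_group X x0"
      unfolding fundamental_group_def
    proof (rule lepoll_quotient[OF equiv, of "\<lambda>r. k \<circ> \<psi> r"])
      show "range (\<lambda>r. k \<circ> \<psi> r) \<subseteq> loops_at X x0"
        using \<psi>(1) kL by auto
      fix r s assume "(k \<circ> \<psi> r, k \<circ> \<psi> s) \<in> loop_homotopic X x0"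
      then have "homotopic_paths S (\<psi> r) (\<psi> s)"
        using \<psi>(1) by (intro from_X) auto
      then show "r = s"
        using \<psi>(2) by blast
    qed
    then show ?thesis
      using upper lepoll_antisym by blast
  qed
qed

end
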